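(* Let $n\ge 3$, $m\ge 1$, and let $\mathcal A^1,\dots,\mathcal A^m$ be maximal subsets of $\{L_{i,j}\}_{1\le i<j\le n}$, each nonempty and different from the whole set $\{L_{i,j}\}_{1\le i<j\le n}$, with associated multi-indices $\alpha_1^J,\dots,\alpha_{N_J}^J$ where $|\alpha^J_1|\ge\dots\ge|\alpha^J_{N_J}|$ (see context). For $J=1,\dots,m$ define $$\widetilde p_J=\max_{L\in(\mathcal A^J)^c}\#\{k\in\{1,\dots,m\}:L\in(\mathcal A^k)^c\},$$ where $(\mathcal A^k)^c=\{L_{i,j}\}_{i<j}\setminus\mathcal A^k$, and $$\widetilde\delta=n-\sum_{J=1}^m\widetilde p_J^{-1}\,(n-|\alpha_1^J|).$$ Then $\widetilde\delta>0$, and there is a constant $C>0$, depending only on $n$ and on the sets $\mathcal A^1,\dots,\mathcal A^m$, such that $$\int_{B(0,R)}\prod_{J=1}^m f_J(x_{\bar\alpha_1^J})\,dx\le C\,R^{\widetilde\delta}\prod_{J=1}^m\|f_J\|_{L^{\widetilde p_J}(\mathbb R^{n-|\alpha_1^J|})}$$ for every $R>0$ and all nonnegative measurable functions $f_J:\mathbb R^{n-|\alpha_1^J|}\to[0,\infty)$ such that, for each $J$, the function $x\mapsto f_J(x_{\bar\alpha_1^J})$ on $\mathbb R^n$ is $\mathcal A^J$-symmetric.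
   Context: For $1\le i<j\le n$ let $L_{i,j}=x_i\partial_{x_j}-x_j\partial_{x_i}$, regarded as elements of the Lie algebra $\mathfrak{so}(n)$. A subset $\mathcal A\subseteq\{L_{i,j}\}_{i<j}$ is maximal if $\mathcal A=\langle\mathcal A\rangle\cap\{L_{i,j}\}_{i<j}$, where $\langle\mathcal A\rangle$ is the Lie subalgebra generated by $\mathcal A$. A multi-index is an element $\alpha\in\{0,1\}^n$ with components $(\alpha)_i$; $|\alpha|=\sum_i(\alpha)_i$; $\bar\alpha=(1,\dots,1)-\alpha$; two multi-indices are orthogonal if they have no $1$'s in a common component. For $x\in\mathbb R^n$, $x_\alpha$ denotes the collection of the coordinates $x_i$ with $(\alpha)_i=1$, viewed as a point of $\mathbb R^{|\alpha|}$. It is known that for every nonempty maximal $\mathcal A$ there are $N\ge1$ and pairwise orthogonal multi-indices $\alpha_1,\dots,\alpha_N$, unique up to relabeling those of equal length, with $|\alpha_1|\ge\dots\ge|\alpha_N|\ge2$, such that $\langle\mathcal A\rangle=\bigoplus_{i=1}^N\mathfrak{so}_{\alpha_i}$, where $\mathfrak{so}_\alpha$ is the Lie algebra generated by $\{L_{k,l}:k<l,\ (\alpha)_k=(\alpha)_l=1\}$; equivalently $\mathcal A=\{L_{k,l}:k<l,\ (\alpha_i)_k=(\alpha_i)_l=1\text{ for some }i\}$. For each $\mathcal A^J$ such a labeling $\alpha^J_1,\dots,\alpha^J_{N_J}$ is fixed. A smooth function $f$ on $\mathbb R^n$ is $\mathcal A$-symmetric if $Xf=0$ for all $X\in\mathcal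 A$; equivalently, it is invariant under all rotations acting, for each $i$, as an element of $SO(|\alpha_i|)$ on the coordinates $x_{\alpha_i}$ and fixing all remaining coordinates. A measurable function on $\mathbb R^n$ is called $\mathcal A$-symmetric if it has this invariance. $B(0,R)$ is the Euclidean ball in $\mathbb R^n$ of center $0$ and radius $R$. *)

theory Defs
  imports "HOL-Analysis.Analysis"
begin

text \<open>
  The space \<open>\<real>\<^sup>n\<close> is \<^typ>\<open>real ^ 'n\<close>, where \<open>'n\<close> is a finite linearly ordered index type with
  \<open>n = CARD('n)\<close>.

  A matrix \<open>M\<close> stands for the linear vector field \<open>\<Sum>k l. M $ k $ l * x\<^sub>k \<partial>\<^sub>l\<close>. With this convention
  (\<open>M\<close> acts on the row vector \<open>x\<close>) the commutator \<open>XY - YX\<close> of vector fields corresponds to the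
  matrix commutator with the same sign, and \<open>x\<^sub>i \<partial>\<^sub>j - x\<^sub>j \<partial>\<^sub>i\<close> is the matrix \<open>L i j\<close> below.
\<close>

definition L :: "'n \<Rightarrow> 'n \<Rightarrow> real ^ 'n ^ 'n" where
  "L i j = (\<chi> k l. if k = i \<and> l = j then 1 else if k = j \<and> l = i then - 1 else 0)"

lemma vector_field_L:
  assumes "i \<noteq> j"
  shows "x v* L i j = x $ i *\<^sub>R axis j 1 - x $ j *\<^sub>R axis i 1"
proof -
  have "(\<Sum>k\<in>UNIV. x $ k * (L i j) $ k $ l)
      = (if l = j then x $ i else 0) - (if l = i then x $ j else 0)" for l
  proof -
    have "(\<Sum>k\<in>UNIV. x $ k * (L i j) $ k $ l)
        = (\<Sum>k\<in>UNIV. (if k = i then (if l = j then x $ k else 0) else 0)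
                   - (if k = j then (if l = i then x $ k else 0) else 0))"
      using assms by (intro sum.cong) (auto simp: L_def)
    then show ?thesis
      by (simp add: sum_subtractf)
  qed
  then show ?thesis
    using assms by (auto simp: vec_eq_iff vector_matrix_mult_def axis_def)
qed

definition Ls :: "(real ^ 'n::{finite,linorder} ^ 'n::{finite,linorder}) set" where
  "Ls = {L i j | i j. i < j}"

definition so :: "(real ^ 'n ^ 'n) set" where
  "so = {M. transpose M = - M}"

definition bracket ::
  "real ^ 'n ^ 'n \<Rightarrow> real ^ 'n ^ 'n \<Rightarrow> real ^ 'n ^ 'n" where
  "bracket X Y = X ** Y - Y ** X"

definition lie_subalgebra :: "(real ^ 'n ^ 'n) set \<Rightarrow> bool" where
  "lie_subalgebra S \<longleftrightarrow> subspace S \<and> S \<subseteq> so \<and> (\<forall>X\<in>S. \<forall>Y\<in>S. bracket X Y \<in> S)"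

definition lie_generated :: "(real ^ 'n ^ 'n) set \<Rightarrow> (real ^ 'n ^ 'n) set" where
  "lie_generated A = lie_subalgebra hull A"

definition maximal :: "(real ^ 'n::{finite,linorder} ^ 'n::{finite,linorder}) set \<Rightarrow> bool" where
  "maximal A \<longleftrightarrow> A \<subseteq> Ls \<and> A = lie_generated A \<inter> Ls"

text \<open>
  A multi-index \<open>\<alpha> \<in> {0,1}\<^sup>n\<close> is encoded as the set of its nonzero components, of type \<^typ>\<open>'n set\<close>.
  Then \<open>|\<alpha>|\<close> is \<^term>\<open>card \<alpha>\<close>, the complementary multi-index is \<^term>\<open>- \<alpha>\<close>, and orthogonality
  is \<^const>\<open>disjnt\<close>.
\<close>

definition so_index ::
  "'n::{finite,linorder} set \<Rightarrow> (real ^ 'n::{finite,linorder} ^ 'n::{finite,linorder}) set" where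
  "so_index \<alpha> = lie_generated {L k l | k l. k < l \<and> k \<in> \<alpha> \<and> l \<in> \<alpha>}"

definition is_direct_sum :: "'v::real_vector set \<Rightarrow> nat \<Rightarrow> (nat \<Rightarrow> 'v set) \<Rightarrow> bool" where
  "is_direct_sum V N S \<longleftrightarrow>
     V = {\<Sum>i=1..N. X i | X. \<forall>i\<in>{1..N}. X i \<in> S i} \<and>
     (\<forall>X. (\<forall>i\<in>{1..N}. X i \<in> S i) \<and> (\<Sum>i=1..N. X i) = 0 \<longrightarrow> (\<forall>i\<in>{1..N}. X i = 0))"

definition labeling ::
  "(real ^ 'n::{finite,linorder} ^ 'n::{finite,linorder}) set
    \<Rightarrow> nat \<Rightarrow> (nat \<Rightarrow> 'n::{finite,linorder} set) \<Rightarrow> bool" where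
  "labeling A N \<alpha> \<longleftrightarrow>
     N \<ge> 1 \<and>
     (\<forall>i\<in>{1..N}. \<forall>j\<in>{1..N}. i \<noteq> j \<longrightarrow> disjnt (\<alpha> i) (\<alpha> j)) \<and>
     (\<forall>i\<in>{1..N}. \<forall>j\<in>{1..N}. i \<le> j \<longrightarrow> card (\<alpha> j) \<le> card (\<alpha> i)) \<and>
     (\<forall>i\<in>{1..N}. card (\<alpha> i) \<ge> 2) \<and>
     is_direct_sum (lie_generated A) N (\<lambda>i. so_index (\<alpha> i))"

text \<open>
  \<open>SO(|\<alpha>|)\<close> acting on the coordinates in \<open>\<alpha>\<close>, each element being extended by the identity to
  all of \<open>\<real>\<^sup>n\<close>: an orthogonal matrix fixing the basis vectors outside \<open>\<alpha>\<close> is block diagonal, and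
  its determinant is that of the \<open>\<alpha>\<close>-block.
\<close>

definition SO_index :: "'n set \<Rightarrow> (real ^ 'n ^ 'n) set" where
  "SO_index \<alpha> = {Q. rotation_matrix Q \<and> (\<forall>k. k \<notin> \<alpha> \<longrightarrow> Q *v axis k 1 = axis k 1)}"

definition admissible_rotation ::
  "nat \<Rightarrow> (nat \<Rightarrow> 'n set) \<Rightarrow> (real ^ 'n \<Rightarrow> real ^ 'n) \<Rightarrow> bool" where
  "admissible_rotation N \<alpha> T \<longleftrightarrow>
     (\<forall>i\<in>{1..N}. \<exists>Q\<in>SO_index (\<alpha> i). \<forall>x. \<forall>k\<in>\<alpha> i. T x $ k = (Q *v x) $ k) \<and>
     (\<forall>x k. k \<notin> (\<Union>i\<in>{1..N}. \<alpha> i) \<longrightarrow> T x $ k = x $ k)"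

definition symmetric_fun ::
  "nat \<Rightarrow> (nat \<Rightarrow> 'n set) \<Rightarrow> (real ^ 'n \<Rightarrow> real) \<Rightarrow> bool" where
  "symmetric_fun N \<alpha> g \<longleftrightarrow> (\<forall>T. admissible_rotation N \<alpha> T \<longrightarrow> (\<forall>x. g (T x) = g x))"

text \<open>
  The space \<open>\<real>\<^bsup>|\<beta>|\<^esup>\<close> of the variables \<open>x\<^sub>\<beta>\<close> consists of the extensional functions on \<open>\<beta>\<close>, with
  Lebesgue measure (the completion of the product Borel measure, like \<^const>\<open>lebesgue\<close>).
\<close>

definition coords :: "'n set \<Rightarrow> real ^ 'n \<Rightarrow> 'n \<Rightarrow> real" where
  "coords \<beta> x = (\<lambda>i\<in>\<beta>. x $ i)"

definition lebesgue_index :: "'n set \<Rightarrow> ('n \<Rightarrow> real) measure" where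
  "lebesgue_index \<beta> = completion (Pi\<^sub>M \<beta> (\<lambda>_. lborel))"

text \<open>The \<open>L\<^sup>p\<close> norm for finite \<open>p\<close>, equal to \<open>\<infinity>\<close> if \<open>f\<close> is not in \<open>L\<^sup>p\<close>.\<close>

definition Lp_norm :: "real \<Rightarrow> 'a measure \<Rightarrow> ('a \<Rightarrow> real) \<Rightarrow> ennreal" where
  "Lp_norm p M f =
     (let I = \<integral>\<^sup>+ y. ennreal (\<bar>f y\<bar> powr p) \<partial>M
      in if I = \<infinity> then \<infinity> else ennreal (enn2real I powr (1 / p)))"

definition p_tilde ::
  "nat \<Rightarrow> (nat \<Rightarrow> (real ^ 'n::{finite,linorder} ^ 'n::{finite,linorder}) set) \<Rightarrow> nat \<Rightarrow> nat" where
  "p_tilde m A J = Max ((\<lambda>X. card {k\<in>{1..m}. X \<in> Ls - A k}) ` (Ls - A J))"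

definition delta_tilde ::
  "nat \<Rightarrow> (nat \<Rightarrow> (real ^ 'n::{finite,linorder} ^ 'n::{finite,linorder}) set)
    \<Rightarrow> (nat \<Rightarrow> nat \<Rightarrow> 'n::{finite,linorder} set) \<Rightarrow> real" where
  "delta_tilde m A \<alpha> =
     real CARD('n) -
     (\<Sum>J=1..m. inverse (real (p_tilde m A J)) * (real CARD('n) - real (card (\<alpha> J 1))))"

end

(*
  Write q_J = 1/p_J. For i <> a the pair L_{a,i} lies outside A^J whenever i is not in the block of a
  for A^J, so the definition of p_J gives the sum of q_J over those J at most 1.

  Cut the ball into the regions where |x_a| is the largest coordinate and x_a has a fixed sign, and
  there replace the coordinate x_a by sigma = |x|^2. On a sphere of radius r = sqrt sigma the function
  f_J is, by rotation invariance, a function of the coordinates outside the block of a only: the block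
  of a may be dropped in place of alpha_1^J. The above bound on the sum of the q_J is then exactly the
  hypothesis of Finner's inequality (a coordinatewise Hoelder inequality) in the remaining
  n - 1 coordinates. The L^p norms of f_J in the new coordinates are compared with the given ones by
  integrating two coordinates of alpha_1^J in polar coordinates; here |alpha_1^J| >= 2 enters. Finally
  sigma^(delta/2 - 1) is integrated over (0, R^2).
*)
theory Submission
  imports Defs "HOL-Probability.Infinite_Product_Measure"
begin

section \<open>Hoelder and Finner inequalities\<close>

text \<open>Finner's inequality does not apply to the f_J as given: it needs the sum of q_J over
  those J with i outside alpha_1^J to be at most 1, and this can fail. For n = 5 and the four sets
  with blocks {1,k} and {2,3,4,5} - {k}, k = 2,...,5, every p_J is 3 and the coordinate i = 1 gives
  4/3. The definition of p_J controls pairs of coordinates; giving up x_a for sigma makes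
  \<open>a\<close> the fixed partner of every i.

  Dropping the block of \<open>a\<close> costs an average. The invariance belongs to f_J and not to
  a Borel majorant of |f_J|^p_J, and setting the block coordinates to 0 would evaluate the majorant
  on a null set. So the majorant is averaged over a cube in the block coordinates other than
  \<open>a\<close>. Radius |x|/n leaves room to solve for x_a, since x_a^2 is at least |x|^2/n in
  the region. The same bound keeps the Jacobian of the passage from x_a to sigma below sqrt n / (2
  r).

  Cube averages are taken with probability measures, for which Hoelder's inequality also holds with
  weights of sum less than 1.\<close>

text \<open>The value at infinity is set by hand since \<open>enn2real\<close> sends infinity to 0.
  At 0 the value is 0 for every exponent, by the convention for \<open>powr\<close>.\<close>

definition epowr :: "real \<Rightarrow> ennreal \<Rightarrow> ennreal" where
  "epowr q x = (if x = \<infinity> then \<infinity> else ennreal (enn2real x powr q))"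

lemma epowr_ennreal: "0 \<le> x \<Longrightarrow> epowr q (ennreal x) = ennreal (x powr q)"
  by (simp add: epowr_def)

lemma epowr_top [simp]: "epowr q top = top"
  by (simp add: epowr_def)

lemma epowr_eq_0_iff: "epowr q x = 0 \<longleftrightarrow> x = 0"
  by (cases x) (auto simp: epowr_def)

lemma epowr_mono:
  assumes "0 \<le> q" "x \<le> y"
  shows "epowr q x \<le> epowr q y"
proof (cases "y = \<infinity>")
  case False
  with assms obtain a b where "x = ennreal a" "y = ennreal b" "0 \<le> a" "0 \<le> b" "a \<le> b"
    by (cases x; cases y) (auto simp: top_unique)
  then show ?thesis
    using assms by (simp add: epowr_ennreal powr_mono2)
qed simp

lemma epowr_cmult:
  assumes "0 < c"
  shows "epowr q (ennreal c * x) = ennreal (c powr q) * epowr q x"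
proof (cases x)
  case (real r)
  then show ?thesis
    using assms by (simp add: epowr_ennreal powr_mult flip: ennreal_mult)
next
  case top
  then show ?thesis
    using assms by (simp add: epowr_def ennreal_mult_top)
qed

lemma measurable_epowr [measurable]:
  assumes [measurable]: "f \<in> borel_measurable M"
  shows "(\<lambda>x. epowr q (f x)) \<in> borel_measurable M"
  unfolding epowr_def by measurable

text \<open>The missing weight 1 - sum q is carried by the number 1, whose logarithm is 0. All terms
  are compared with the tangent line of exp at m, the weighted mean of the logarithms.\<close>

lemma weighted_am_gm:
  fixes q t :: "'i \<Rightarrow> real"
  assumes S: "finite S" and q: "\<And>j. j \<in> S \<Longrightarrow> 0 < q j" "sum q S \<le> 1"
    and t: "\<And>j. j \<in> S \<Longrightarrow> 0 \<le> t j"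
  shows "(\<Prod>j\<in>S. t j powr q j) \<le> (\<Sum>j\<in>S. q j * t j) + (1 - sum q S)"
proof (cases "\<exists>j\<in>S. t j = 0")
  case True
  then have "(\<Prod>j\<in>S. t j powr q j) = 0"
    using S by (auto intro!: prod_zero)
  moreover have "0 \<le> (\<Sum>j\<in>S. q j * t j)"
    using q t by (intro sum_nonneg mult_nonneg_nonneg) (auto intro: less_imp_le)
  ultimately show ?thesis
    using q by simp
next
  case False
  then have t: "\<And>j. j \<in> S \<Longrightarrow> 0 < t j"
    using t by force
  define m where "m = (\<Sum>j\<in>S. q j * ln (t j))"
  have prod: "(\<Prod>j\<in>S. t j powr q j) = exp m"
    unfolding m_def exp_sum[OF S] using t by (intro prod.cong) (force simp: powr_def)+
  have tangent: "exp m * (1 + (u - m)) \<le> exp u" for u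
  proof -
    have "exp m * (1 + (u - m)) \<le> exp m * exp (u - m)"
      by (intro mult_left_mono exp_ge_add_one_self) auto
    then show ?thesis
      by (simp flip: exp_add)
  qed
  have "(\<Sum>j\<in>S. q j * (exp m * (1 + (ln (t j) - m)))) \<le> (\<Sum>j\<in>S. q j * t j)"
  proof (intro sum_mono mult_left_mono)
    fix j assume "j \<in> S"
    then show "exp m * (1 + (ln (t j) - m)) \<le> t j" "0 \<le> q j"
      using tangent[of "ln (t j)"] t[of j] q(1)[of j] by (auto simp: less_imp_le)
  qed
  moreover have "(\<Sum>j\<in>S. q j * (exp m * (1 + (ln (t j) - m))))
      = exp m * (sum q S * (1 - m) + m)"
  proof -
    have "(\<Sum>j\<in>S. q j * (exp m * (1 + (ln (t j) - m))))
        = (\<Sum>j\<in>S. exp m * (q j * (1 - m) + q j * ln (t j)))"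
      by (intro sum.cong) (auto simp: algebra_simps)
    then show ?thesis
      by (simp only: sum_distrib_left[symmetric] sum_distrib_right[symmetric] sum.distrib m_def[symmetric])
  qed
  moreover have "(1 - sum q S) * (exp m * (1 + (0 - m))) \<le> (1 - sum q S) * exp 0"
    using q(2) by (intro mult_left_mono tangent) auto
  moreover have "exp m = exp m * (sum q S * (1 - m) + m) + (1 - sum q S) * (exp m * (1 + (0 - m)))"
    by (simp add: algebra_simps)
  ultimately have "exp m \<le> (\<Sum>j\<in>S. q j * t j) + (1 - sum q S)"
    by simp
  then show ?thesis
    by (simp add: prod)
qed

lemma weighted_am_gm_ennreal:
  fixes q :: "'i \<Rightarrow> real" and t :: "'i \<Rightarrow> ennreal"
  assumes S: "finite S" and q: "\<And>j. j \<in> S \<Longrightarrow> 0 < q j" "sum q S \<le> 1"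
  shows "(\<Prod>j\<in>S. epowr (q j) (t j)) \<le> (\<Sum>j\<in>S. ennreal (q j) * t j) + ennreal (1 - sum q S)"
proof (cases "\<exists>j\<in>S. t j = \<infinity>")
  case True
  then obtain j where j: "j \<in> S" "t j = \<infinity>"
    by auto
  then have "ennreal (q j) * t j = \<infinity>"
    using q(1)[OF j(1)] by (simp add: ennreal_mult_top)
  then have "(\<Sum>j\<in>S. ennreal (q j) * t j) = \<infinity>"
    using S j by (subst sum.remove[of S j]) auto
  then show ?thesis
    by simp
next
  case False
  then have t: "\<And>j. j \<in> S \<Longrightarrow> t j = ennreal (enn2real (t j))"
    by (auto simp: less_top[symmetric])
  have "(\<Prod>j\<in>S. epowr (q j) (t j)) = (\<Prod>j\<in>S. ennreal (enn2real (t j) powr q j))"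
    using False by (intro prod.cong) (auto simp: epowr_def)
  also have "\<dots> = ennreal (\<Prod>j\<in>S. enn2real (t j) powr q j)"
    by (intro prod_ennreal) auto
  also have "\<dots> \<le> ennreal ((\<Sum>j\<in>S. q j * enn2real (t j)) + (1 - sum q S))"
    using S q by (intro ennreal_leI weighted_am_gm) auto
  also have "\<dots> = (\<Sum>j\<in>S. ennreal (q j * enn2real (t j))) + ennreal (1 - sum q S)"
    using q by (subst ennreal_plus, intro sum_nonneg)
      (auto intro!: less_imp_le sum_ennreal[symmetric] simp: less_imp_le)
  also have "(\<Sum>j\<in>S. ennreal (q j * enn2real (t j))) = (\<Sum>j\<in>S. ennreal (q j) * t j)"
    using q t by (intro sum.cong refl) (metis ennreal_mult enn2real_nonneg less_imp_le)
  finally show ?thesis .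
qed

text \<open>After division of each h_j by its integral, the pointwise weighted mean inequality
  integrates to sum q + (1 - sum q) = 1; the constant term integrates to itself because the total
  mass is 1.\<close>

lemma (in prob_space) hoelder_nn_integral:
  fixes q :: "'i \<Rightarrow> real" and h :: "'i \<Rightarrow> 'a \<Rightarrow> ennreal"
  assumes S: "finite S" and q: "\<And>j. j \<in> S \<Longrightarrow> 0 < q j" "sum q S \<le> 1"
    and [measurable]: "\<And>j. j \<in> S \<Longrightarrow> h j \<in> borel_measurable M"
  shows "(\<integral>\<^sup>+x. (\<Prod>j\<in>S. epowr (q j) (h j x)) \<partial>M) \<le> (\<Prod>j\<in>S. epowr (q j) (\<integral>\<^sup>+x. h j x \<partial>M))"
proof -
  define I where "I j = (\<integral>\<^sup>+x. h j x \<partial>M)" for j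
  \<comment> \<open>A vanishing integral comes first: it makes the left side 0 even if another
    integral is infinite. Only when all integrals are nonzero does an infinite one make the right
    side infinite.\<close>
  consider j where "j \<in> S" "I j = 0" | j where "\<forall>j\<in>S. I j \<noteq> 0" "j \<in> S" "I j = \<infinity>"
    | "\<forall>j\<in>S. I j \<noteq> 0 \<and> I j \<noteq> \<infinity>"
    by blast
  then show ?thesis
  proof cases
    case (1 j)
    then have "AE x in M. h j x = 0"
      by (simp add: I_def nn_integral_0_iff_AE)
    then have "AE x in M. (\<Prod>j\<in>S. epowr (q j) (h j x)) = 0"
      by eventually_elim (use S 1 in \<open>auto intro!: prod_zero simp: epowr_eq_0_iff\<close>)
    then have "(\<integral>\<^sup>+x. (\<Prod>j\<in>S. epowr (q j) (h j x)) \<partial>M) = 0"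
      using S by (subst nn_integral_0_iff_AE) auto
    then show ?thesis
      by simp
  next
    case (2 j)
    then have "(\<Prod>j\<in>S. epowr (q j) (I j)) = \<infinity>"
      using S by (auto simp: ennreal_prod_eq_top epowr_eq_0_iff intro!: bexI[of _ j])
    then show ?thesis
      by (simp add: I_def)
  next
    case 3
    define c where "c j = enn2real (I j)" for j
    have c: "c j > 0" "I j = ennreal (c j)" if "j \<in> S" for j
      using 3 that by (auto simp: c_def enn2real_positive_iff less_top zero_less_iff_neq_zero)
    have "(\<integral>\<^sup>+x. (\<Prod>j\<in>S. epowr (q j) (h j x)) \<partial>M)
        = (\<integral>\<^sup>+x. (\<Prod>j\<in>S. epowr (q j) (I j)) * (\<Prod>j\<in>S. epowr (q j) (ennreal (1 / c j) * h j x)) \<partial>M)"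
    proof (intro nn_integral_cong)
      fix x
      have "epowr (q j) (h j x) = epowr (q j) (I j) * epowr (q j) (ennreal (1 / c j) * h j x)" if "j \<in> S" for j
      proof -
        have "epowr (q j) (I j) * epowr (q j) (ennreal (1 / c j) * h j x)
          = ennreal (c j powr q j) * ennreal ((1 / c j) powr q j) * epowr (q j) (h j x)"
          using c[OF that] by (simp add: epowr_cmult epowr_ennreal mult.assoc)
        also have "ennreal (c j powr q j) * ennreal ((1 / c j) powr q j) = 1"
          using c[OF that] by (simp add: ennreal_mult[symmetric] powr_mult[symmetric])
        finally show ?thesis by simp
      qed
      then show "(\<Prod>j\<in>S. epowr (q j) (h j x))
          = (\<Prod>j\<in>S. epowr (q j) (I j)) * (\<Prod>j\<in>S. epowr (q j) (ennreal (1 / c j) * h j x))"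
        by (simp add: prod.distrib)
    qed
    also have "\<dots> = (\<Prod>j\<in>S. epowr (q j) (I j)) * (\<integral>\<^sup>+x. (\<Prod>j\<in>S. epowr (q j) (ennreal (1 / c j) * h j x)) \<partial>M)"
      using S by (intro nn_integral_cmult) measurable
    also have "\<dots> \<le> (\<Prod>j\<in>S. epowr (q j) (I j)) *
        (\<integral>\<^sup>+x. (\<Sum>j\<in>S. ennreal (q j) * (ennreal (1 / c j) * h j x)) + ennreal (1 - sum q S) \<partial>M)"
      using S q by (intro mult_left_mono nn_integral_mono weighted_am_gm_ennreal) auto
    also have "(\<integral>\<^sup>+x. (\<Sum>j\<in>S. ennreal (q j) * (ennreal (1 / c j) * h j x)) + ennreal (1 - sum q S) \<partial>M)
        = (\<Sum>j\<in>S. ennreal (q j) * (ennreal (1 / c j) * I j)) + ennreal (1 - sum q S)"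
      using S by (simp add: nn_integral_add nn_integral_sum nn_integral_cmult emeasure_space_1 I_def)
    also have "(\<Sum>j\<in>S. ennreal (q j) * (ennreal (1 / c j) * I j)) = (\<Sum>j\<in>S. ennreal (q j))"
    proof (intro sum.cong refl)
      fix j assume "j \<in> S"
      then have "ennreal (1 / c j) * I j = 1"
        using c[of j] by (simp add: ennreal_mult[symmetric])
      then show "ennreal (q j) * (ennreal (1 / c j) * I j) = ennreal (q j)"
        by simp
    qed
    also have "\<dots> + ennreal (1 - sum q S) = 1"
      using q by (subst sum_ennreal) (auto simp: less_imp_le sum_nonneg simp flip: ennreal_plus)
    finally show ?thesis
      by (simp add: I_def)
  qed
qed

text \<open>Integrating out one variable at a time: Hoelder's inequality in the variable \<open>i\<close> only
  involves the factors that depend on it.\<close>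

lemma finner_inequality:
  fixes q :: "'j \<Rightarrow> real" and h :: "'j \<Rightarrow> ('i \<Rightarrow> 'a) \<Rightarrow> ennreal"
  assumes M: "\<And>i. prob_space (M i)"
    and I: "finite I" and S: "finite S" and q: "\<And>j. j \<in> S \<Longrightarrow> 0 < q j"
    and "\<And>j. j \<in> S \<Longrightarrow> h j \<in> borel_measurable (Pi\<^sub>M I M)"
    and "\<And>j i x t. j \<in> S \<Longrightarrow> i \<in> I \<Longrightarrow> i \<notin> D j \<Longrightarrow> x \<in> space (Pi\<^sub>M I M) \<Longrightarrow>
      t \<in> space (M i) \<Longrightarrow> h j (x(i := t)) = h j x"
    and "\<And>i. i \<in> I \<Longrightarrow> (\<Sum>j | j \<in> S \<and> i \<in> D j. q j) \<le> 1"
  shows "(\<integral>\<^sup>+x. (\<Prod>j\<in>S. epowr (q j) (h j x)) \<partial>Pi\<^sub>M I M)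
    \<le> (\<Prod>j\<in>S. epowr (q j) (\<integral>\<^sup>+x. h j x \<partial>Pi\<^sub>M I M))"
  using I assms(5-)
proof (induction I arbitrary: h rule: finite_induct)
  interpret product_sigma_finite M
    using M by (intro product_sigma_finite.intro prob_space_imp_sigma_finite)
  {
    case empty
    show ?case
      by (simp add: nn_integral_empty)
  next
    case (insert i I)
    note [measurable] = insert.prems(1)
    interpret i: prob_space "M i" by (rule M)
    define S' where "S' = {j \<in> S. i \<in> D j}"
    \<comment> \<open>The partial integrals \<open>P j\<close> go into the induction hypothesis. A
      factor independent of x_i equals its own partial integral, as \<open>M i\<close> has mass 1,
      and can be pulled out of the integral over x_i.\<close>
    define P where "P j x = (\<integral>\<^sup>+t. h j (x(i := t)) \<partial>M i)" for j x
    have upd: "(\<lambda>(x, t). x(i := t)) \<in> Pi\<^sub>M I M \<Otimes>\<^sub>M M i \<rightarrow>\<^sub>M Pi\<^sub>M (insert i I) M"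
      by measurable
    have hm: "(\<lambda>(x, t). h j (x(i := t))) \<in> borel_measurable (Pi\<^sub>M I M \<Otimes>\<^sub>M M i)" if "j \<in> S" for j
      using measurable_compose[OF upd insert.prems(1)[OF that]] by (simp add: split_beta' del: fun_upd_apply)
    have Pm: "P j \<in> borel_measurable (Pi\<^sub>M I M)" if "j \<in> S" for j
      unfolding P_def using hm[OF that] by (rule sigma_finite_measure.borel_measurable_nn_integral[OF prob_space_imp_sigma_finite[OF M]])
    have step: "(\<integral>\<^sup>+t. (\<Prod>j\<in>S. epowr (q j) (h j (x(i := t)))) \<partial>M i) \<le> (\<Prod>j\<in>S. epowr (q j) (P j x))"
      if x: "x \<in> space (Pi\<^sub>M I M)" for x
    proof -
      obtain t0 where t0: "t0 \<in> space (M i)"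
        using i.not_empty by auto
      have upd_space: "x(i := t) \<in> space (Pi\<^sub>M (insert i I) M)" if "t \<in> space (M i)" for t
        using measurable_space[OF upd, of "(x, t)"] x that by (simp add: space_pair_measure)
      have const: "h j (x(i := t)) = P j x" if "j \<in> S - S'" "t \<in> space (M i)" for j t
      proof -
        have "h j (x(i := t')) = h j (x(i := t))" if "t' \<in> space (M i)" for t'
          using insert.prems(2)[of j i "x(i := t)" t'] upd_space that \<open>j \<in> S - S'\<close> \<open>t \<in> space (M i)\<close>
          by (auto simp: S'_def simp del: fun_upd_apply)
        then have "P j x = (\<integral>\<^sup>+t'. h j (x(i := t)) \<partial>M i)"
          unfolding P_def by (intro nn_integral_cong) auto
        then show ?thesis
          by (simp add: i.emeasure_space_1)
      qed
      have slice: "(\<lambda>t. h j (x(i := t))) \<in> borel_measurable (M i)" if "j \<in> S" for j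
        using hm[OF that] x by (auto intro: measurable_Pair2)
      have "(\<integral>\<^sup>+t. (\<Prod>j\<in>S. epowr (q j) (h j (x(i := t)))) \<partial>M i)
          = (\<integral>\<^sup>+t. (\<Prod>j\<in>S - S'. epowr (q j) (P j x)) * (\<Prod>j\<in>S'. epowr (q j) (h j (x(i := t)))) \<partial>M i)"
      proof (intro nn_integral_cong)
        fix t assume "t \<in> space (M i)"
        then have "(\<Prod>j\<in>S - S'. epowr (q j) (P j x)) = (\<Prod>j\<in>S - S'. epowr (q j) (h j (x(i := t))))"
          by (intro prod.cong) (simp_all add: const)
        then show "(\<Prod>j\<in>S. epowr (q j) (h j (x(i := t))))
          = (\<Prod>j\<in>S - S'. epowr (q j) (P j x)) * (\<Prod>j\<in>S'. epowr (q j) (h j (x(i := t))))"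
          using S by (subst prod.subset_diff[of S' S]) (auto simp: S'_def)
      qed
      also have "\<dots> = (\<Prod>j\<in>S - S'. epowr (q j) (P j x)) * (\<integral>\<^sup>+t. (\<Prod>j\<in>S'. epowr (q j) (h j (x(i := t)))) \<partial>M i)"
        using slice by (intro nn_integral_cmult borel_measurable_prod measurable_epowr) (auto simp: S'_def)
      also have "\<dots> \<le> (\<Prod>j\<in>S - S'. epowr (q j) (P j x)) * (\<Prod>j\<in>S'. epowr (q j) (P j x))"
        unfolding P_def using insert.prems(3)[of i] S q slice
        by (intro mult_left_mono i.hoelder_nn_integral) (auto simp: S'_def)
      also have "\<dots> = (\<Prod>j\<in>S. epowr (q j) (P j x))"
        using S by (subst prod.subset_diff[of S' S]) (auto simp: S'_def)
      finally show ?thesis .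
    qed
    have "(\<integral>\<^sup>+x. (\<Prod>j\<in>S. epowr (q j) (h j x)) \<partial>Pi\<^sub>M (insert i I) M)
        = (\<integral>\<^sup>+x. (\<integral>\<^sup>+t. (\<Prod>j\<in>S. epowr (q j) (h j (x(i := t)))) \<partial>M i) \<partial>Pi\<^sub>M I M)"
      using insert.hyps by (intro product_nn_integral_insert) measurable
    also have "\<dots> \<le> (\<integral>\<^sup>+x. (\<Prod>j\<in>S. epowr (q j) (P j x)) \<partial>Pi\<^sub>M I M)"
      by (intro nn_integral_mono step)
    also have "\<dots> \<le> (\<Prod>j\<in>S. epowr (q j) (\<integral>\<^sup>+x. P j x \<partial>Pi\<^sub>M I M))"
    proof (rule insert.IH[OF Pm])
      fix j k x t assume *: "j \<in> S" "k \<in> I" "k \<notin> D j" "x \<in> space (Pi\<^sub>M I M)" "t \<in> space (M k)"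
      have "h j ((x(k := t))(i := s)) = h j (x(i := s))" if "s \<in> space (M i)" for s
      proof -
        have "x(i := s) \<in> space (Pi\<^sub>M (insert i I) M)"
          using measurable_space[OF upd, of "(x, s)"] * that by (simp add: space_pair_measure)
        moreover have "(x(k := t))(i := s) = (x(i := s))(k := t)"
          using * insert.hyps by (auto simp: fun_eq_iff)
        ultimately show ?thesis
          using insert.prems(2)[of j k "x(i := s)" t] * by (simp del: fun_upd_apply)
      qed
      then show "P j (x(k := t)) = P j x"
        unfolding P_def by (intro nn_integral_cong) auto
    qed (use insert.prems in auto)
    also have "\<dots> = (\<Prod>j\<in>S. epowr (q j) (\<integral>\<^sup>+x. h j x \<partial>Pi\<^sub>M (insert i I) M))"
      using insert.hyps unfolding P_def
      by (intro prod.cong refl, subst product_nn_integral_insert) auto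
    finally show ?case .
  }
qed

section \<open>One- and two-dimensional substitutions\<close>

text \<open>Substitution on the bounded intervals [0, k + 1], followed by monotone convergence in
  k.\<close>

lemma nn_integral_square_substitution:
  fixes F :: "real \<Rightarrow> ennreal"
  assumes [measurable]: "F \<in> borel_measurable borel"
  shows "(\<integral>\<^sup>+t. F (t\<^sup>2) * ennreal (2 * t) * indicator {0..} t \<partial>lborel)
    = (\<integral>\<^sup>+s. F s * indicator {0..} s \<partial>lborel)"
proof -
  have bounded: "(\<integral>\<^sup>+s. F s * indicator {0..(real (Suc k))\<^sup>2} s \<partial>lborel)
      = (\<integral>\<^sup>+t. F (t\<^sup>2) * ennreal (2 * t) * indicator {0..real (Suc k)} t \<partial>lborel)" for k :: nat
  proof -
    have "((\<lambda>t::real. t\<^sup>2) has_real_derivative 2 * x) (at x)" for x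
      by (auto intro!: derivative_eq_intros)
    then show ?thesis
      using nn_integral_substitution_aux[of F 0 "real (Suc k)" "\<lambda>t. t\<^sup>2" "\<lambda>t. 2 * t"]
      by (simp add: continuous_intros)
  qed
  have sup: "(SUP k. G x * indicator {0..f k} x) = G x * indicator {0..} x"
    if "filterlim f at_top sequentially" for G :: "real \<Rightarrow> ennreal" and f :: "nat \<Rightarrow> real" and x
  proof (rule antisym)
    show "(SUP k. G x * indicator {0..f k} x) \<le> G x * indicator {0..} x"
      by (rule SUP_least) (auto simp: indicator_def)
    have "eventually (\<lambda>k. x \<le> f k) sequentially"
      using that by (auto simp: filterlim_at_top)
    then obtain k where "x \<le> f k"
      using eventually_happens'[OF sequentially_bot] by blast
    then have "G x * indicator {0..} x \<le> G x * indicator {0..f k} x"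
      by (auto simp: indicator_def)
    then show "G x * indicator {0..} x \<le> (SUP k. G x * indicator {0..f k} x)"
      by (rule SUP_upper2[rotated]) simp
  qed
  have mono: "incseq (\<lambda>k x. G x * indicator {0..f k} x)"
    if "incseq f" for G :: "real \<Rightarrow> ennreal" and f :: "nat \<Rightarrow> real"
    using that by (auto simp: incseq_def le_fun_def indicator_def intro: order_trans)
  have lim: "filterlim (\<lambda>k. real (Suc k)) at_top sequentially"
    using filterlim_real_sequentially by (rule filterlim_compose) (rule filterlim_Suc)
  have sq: "incseq (\<lambda>k. (real (Suc k))\<^sup>2)" "filterlim (\<lambda>k. (real (Suc k))\<^sup>2) at_top sequentially"
    using lim by (auto simp: incseq_def intro!: power_mono filterlim_pow_at_top)
  have id: "incseq (\<lambda>k. real (Suc k))"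
    by (auto simp: incseq_def)
  have "(\<integral>\<^sup>+s. F s * indicator {0..} s \<partial>lborel)
      = (\<integral>\<^sup>+s. (SUP k. F s * indicator {0..(real (Suc k))\<^sup>2} s) \<partial>lborel)"
    by (simp only: sup[OF sq(2)])
  also have "\<dots> = (SUP k. \<integral>\<^sup>+s. F s * indicator {0..(real (Suc k))\<^sup>2} s \<partial>lborel)"
    using mono[OF sq(1)] by (intro nn_integral_monotone_convergence_SUP) auto
  also have "\<dots> = (SUP k. \<integral>\<^sup>+t. F (t\<^sup>2) * ennreal (2 * t) * indicator {0..real (Suc k)} t \<partial>lborel)"
    by (simp only: bounded)
  also have "\<dots> = (\<integral>\<^sup>+t. (SUP k. F (t\<^sup>2) * ennreal (2 * t) * indicator {0..real (Suc k)} t) \<partial>lborel)"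
    using mono[OF id] by (intro nn_integral_monotone_convergence_SUP[symmetric]) auto
  also have "\<dots> = (\<integral>\<^sup>+t. F (t\<^sup>2) * ennreal (2 * t) * indicator {0..} t \<partial>lborel)"
    by (simp only: sup[OF lim, of "\<lambda>t. F (t\<^sup>2) * ennreal (2 * t)"])
  finally show ?thesis ..
qed

text \<open>The disc of squared radius s has area pi s, so the squared norm pushes planar Lebesgue
  measure forward to pi times Lebesgue measure on the half line.\<close>

lemma nn_integral_radial_plane:
  fixes F :: "real \<Rightarrow> ennreal"
  assumes [measurable]: "F \<in> borel_measurable borel"
  shows "(\<integral>\<^sup>+s. (\<integral>\<^sup>+t. F (s\<^sup>2 + t\<^sup>2) \<partial>lborel) \<partial>lborel)
    = ennreal pi * (\<integral>\<^sup>+s. F s * indicator {0..} s \<partial>lborel)"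
proof -
  \<comment> \<open>The negation turns the half lines \<open>{x<..}\<close> compared by
    \<open>measure_eqI_lessThan\<close> into discs of finite area; without it they would be
    complements of discs.\<close>
  define M where "M = distr (lborel :: (real \<times> real) measure) borel (\<lambda>z. - (norm z)\<^sup>2)"
  define N where "N = distr (density lborel (\<lambda>s. ennreal pi * indicator {0..} s)) borel (\<lambda>s::real. - s)"
  have M: "emeasure M {x<..} = (if x < 0 then ennreal (pi * (- x)) else 0)" for x
  proof -
    have "emeasure M {x<..} = emeasure lborel {z :: real \<times> real. (norm z)\<^sup>2 < - x}"
      unfolding M_def by (subst emeasure_distr) (auto intro!: arg_cong2[where f=emeasure])
    also have "{z :: real \<times> real. (norm z)\<^sup>2 < - x} = (if x < 0 then ball 0 (sqrt (- x)) else {})"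
    proof -
      have "(norm z)\<^sup>2 < - x \<longleftrightarrow> norm z < sqrt (- x)" for z :: "real \<times> real"
        by (metis norm_ge_zero real_sqrt_abs abs_of_nonneg real_sqrt_less_iff)
      moreover have "\<not> (norm z)\<^sup>2 < - x" if "0 \<le> x" for z :: "real \<times> real"
        using that zero_le_power2[of "norm z"] by linarith
      ultimately show ?thesis
        by auto
    qed
    also have "emeasure lborel \<dots> = (if x < 0 then ennreal (pi * (- x)) else 0)"
      by (auto simp: emeasure_ball unit_ball_vol_2)
    finally show ?thesis .
  qed
  have N: "emeasure N {x<..} = (if x < 0 then ennreal (pi * (- x)) else 0)" for x
  proof -
    have "emeasure N {x<..} = emeasure (density lborel (\<lambda>s. ennreal pi * indicator {0..} s)) {..<-x}"
      unfolding N_def by (subst emeasure_distr) (auto intro!: arg_cong2[where f=emeasure])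
    also have "\<dots> = (\<integral>\<^sup>+s. ennreal pi * indicator ({0..<-x}) s \<partial>lborel)"
      by (subst emeasure_density) (auto intro!: nn_integral_cong simp: indicator_def)
    also have "\<dots> = ennreal pi * emeasure lborel {0..<-x}"
      by (simp add: nn_integral_cmult_indicator)
    also have "\<dots> = (if x < 0 then ennreal (pi * (- x)) else 0)"
      by (auto simp: ennreal_mult[symmetric])
    finally show ?thesis .
  qed
  have "M = N"
    by (rule measure_eqI_lessThan) (auto simp: M N, auto simp: M_def N_def)
  then have "integral\<^sup>N M (\<lambda>s. F (- s)) = integral\<^sup>N N (\<lambda>s. F (- s))"
    by simp
  moreover have "integral\<^sup>N M (\<lambda>s. F (- s)) = (\<integral>\<^sup>+z. F ((norm z)\<^sup>2) \<partial>(lborel :: (real \<times> real) measure))"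
    unfolding M_def by (subst nn_integral_distr) auto
  moreover have "\<dots> = (\<integral>\<^sup>+s. (\<integral>\<^sup>+t. F (s\<^sup>2 + t\<^sup>2) \<partial>lborel) \<partial>lborel)"
    unfolding lborel_prod[symmetric]
  proof (subst lborel.nn_integral_fst[symmetric])
    have "(\<lambda>z. F ((norm z)\<^sup>2)) \<in> borel_measurable (borel :: (real \<times> real) measure)"
      by measurable
    then show "(\<lambda>z. F ((norm z)\<^sup>2)) \<in> borel_measurable (lborel \<Otimes>\<^sub>M lborel :: (real \<times> real) measure)"
      by (simp add: lborel_prod)
  qed (simp add: norm_Pair)
  moreover have "integral\<^sup>N N (\<lambda>s. F (- s)) = (\<integral>\<^sup>+s. ennreal pi * (F s * indicator {0..} s) \<partial>lborel)"
    unfolding N_def by (subst nn_integral_distr) (auto simp: nn_integral_density mult_ac)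
  ultimately show ?thesis
    by (simp add: nn_integral_cmult)
qed

text \<open>In polar coordinates, and then with v = sqrt (K - s^2 - t^2), the area element becomes 2
  pi v dv, and v is at most \<rho>. Two integrations over s and t are thus traded for one over v at
  the cost 2 pi \<rho>.\<close>

lemma nn_integral_sphere_fibre:
  fixes \<phi> :: "real \<Rightarrow> ennreal"
  assumes [measurable]: "\<phi> \<in> borel_measurable borel" and e: "\<bar>e\<bar> = 1" and \<rho>: "0 \<le> \<rho>" "K \<le> \<rho>\<^sup>2"
  shows "(\<integral>\<^sup>+s. (\<integral>\<^sup>+t. indicator {..K} (s\<^sup>2 + t\<^sup>2) * \<phi> (e * sqrt (K - (s\<^sup>2 + t\<^sup>2))) \<partial>lborel) \<partial>lborel)
    \<le> ennreal (2 * pi * \<rho>) * (\<integral>\<^sup>+v. \<phi> v \<partial>lborel)"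
proof -
  have "(\<integral>\<^sup>+s. (\<integral>\<^sup>+t. indicator {..K} (s\<^sup>2 + t\<^sup>2) * \<phi> (e * sqrt (K - (s\<^sup>2 + t\<^sup>2))) \<partial>lborel) \<partial>lborel)
    = ennreal pi * (\<integral>\<^sup>+s. indicator {..K} s * \<phi> (e * sqrt (K - s)) * indicator {0..} s \<partial>lborel)"
    by (rule nn_integral_radial_plane) measurable
  \<comment> \<open>The reflection s -> K - s maps the interval [0, K] onto itself.\<close>
  also have "(\<integral>\<^sup>+s. indicator {..K} s * \<phi> (e * sqrt (K - s)) * indicator {0..} s \<partial>lborel)
      = (\<integral>\<^sup>+s. indicator {..K} s * \<phi> (e * sqrt s) * indicator {0..} s \<partial>lborel)"
    by (subst nn_integral_real_affine[where c="-1" and t=K])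
       (auto intro!: nn_integral_cong simp: indicator_def)
  also have "\<dots> = (\<integral>\<^sup>+t. indicator {..K} (t\<^sup>2) * \<phi> (e * sqrt (t\<^sup>2)) * ennreal (2 * t) * indicator {0..} t \<partial>lborel)"
    by (rule nn_integral_square_substitution[symmetric]) measurable
  also have "\<dots> \<le> (\<integral>\<^sup>+t. ennreal (2 * \<rho>) * \<phi> (e * t) \<partial>lborel)"
  proof (intro nn_integral_mono)
    fix t :: real
    have "2 * t \<le> 2 * \<rho>" if "t\<^sup>2 \<le> K"
      using that \<rho> by (metis abs_le_square_iff abs_of_nonneg abs_le_D1 mult_left_mono order_trans zero_le_numeral)
    then show "indicator {..K} (t\<^sup>2) * \<phi> (e * sqrt (t\<^sup>2)) * ennreal (2 * t) * indicator {0..} t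
      \<le> ennreal (2 * \<rho>) * \<phi> (e * t)"
      by (auto simp: indicator_def mult.commute intro!: mult_left_mono ennreal_leI)
  qed
  also have "\<dots> = ennreal (2 * \<rho>) * (\<integral>\<^sup>+t. \<phi> (e * t) \<partial>lborel)"
    by (rule nn_integral_cmult) measurable
  also have "(\<integral>\<^sup>+t. \<phi> (e * t) \<partial>lborel) = (\<integral>\<^sup>+t. \<phi> t \<partial>lborel)"
    using e by (subst (2) nn_integral_real_affine[where c=e and t=0]) auto
  also have "ennreal pi * (ennreal (2 * \<rho>) * (\<integral>\<^sup>+v. \<phi> v \<partial>lborel))
      = ennreal (2 * pi * \<rho>) * (\<integral>\<^sup>+v. \<phi> v \<partial>lborel)"
    using \<rho> by (simp add: mult.assoc[symmetric] ennreal_mult[symmetric] mult.commute)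
  finally show ?thesis
    by (simp add: mult_left_mono)
qed

text \<open>The substitution s = c + t^2 has density 1 / (2 sqrt (s - c)), unbounded near s = c. The
  support hypothesis keeps s - c at least s / \<kappa>^2, which bounds the density by \<kappa> / (2
  sqrt s), independently of c. In the application \<kappa> = sqrt n, because x_a is the largest
  coordinate.\<close>

lemma nn_integral_half_line_square:
  fixes \<Psi> :: "real \<Rightarrow> ennreal"
  assumes [measurable]: "\<Psi> \<in> borel_measurable borel" and \<kappa>: "0 < \<kappa>" and e: "\<bar>e\<bar> = 1"
    and support: "\<And>s. s \<le> 0 \<Longrightarrow> \<Psi> s = 0" "\<And>s. \<Psi> s \<noteq> 0 \<Longrightarrow> s \<le> \<kappa>\<^sup>2 * (s - c)"
  shows "(\<integral>\<^sup>+t. \<Psi> (c + t\<^sup>2) * indicator {0..} (e * t) \<partial>lborel)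
    \<le> (\<integral>\<^sup>+s. ennreal (\<kappa> / (2 * sqrt s)) * \<Psi> s \<partial>lborel)"
proof -
  have "(\<integral>\<^sup>+t. \<Psi> (c + t\<^sup>2) * indicator {0..} (e * t) \<partial>lborel)
      = (\<integral>\<^sup>+t. \<Psi> (c + t\<^sup>2) * indicator {0..} t \<partial>lborel)"
  proof -
    have "e * e = 1"
      using e by (auto simp: abs_if split: if_splits)
    then have "(e * t)\<^sup>2 = t\<^sup>2" "e * (e * t) = t" for t
      by (metis mult.left_neutral power2_eq_square power_mult_distrib, metis mult.assoc mult_1)
    then show ?thesis
      using e by (subst nn_integral_real_affine[where c=e and t=0]) auto
  qed
  \<comment> \<open>Cancelling 2 t against 2 sqrt (t^2) fails at t = 0, where division by zero gives
    0; hence the argument almost everywhere.\<close>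
  also have "\<dots> = (\<integral>\<^sup>+t. (\<Psi> (c + t\<^sup>2) * ennreal (1 / (2 * sqrt (t\<^sup>2)))) * ennreal (2 * t) * indicator {0..} t \<partial>lborel)"
    by (rule nn_integral_cong_AE, rule eventually_mono[OF AE_lborel_singleton[of 0]])
      (auto simp: indicator_def mult.assoc ennreal_mult[symmetric])
  also have "\<dots> = (\<integral>\<^sup>+s. (\<Psi> (c + s) * ennreal (1 / (2 * sqrt s))) * indicator {0..} s \<partial>lborel)"
    by (rule nn_integral_square_substitution[where F = "\<lambda>s. \<Psi> (c + s) * ennreal (1 / (2 * sqrt s))"]) measurable
  also have "\<dots> \<le> (\<integral>\<^sup>+s. ennreal (\<kappa> / (2 * sqrt (c + s))) * \<Psi> (c + s) \<partial>lborel)"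
  proof (intro nn_integral_mono)
    fix s :: real
    have "1 / (2 * sqrt s) \<le> \<kappa> / (2 * sqrt (c + s))" if "\<Psi> (c + s) \<noteq> 0" "0 \<le> s"
    proof -
      have pos: "0 < c + s" "c + s \<le> \<kappa>\<^sup>2 * s"
        using support[of "c + s"] that by force+
      then have "0 < s"
        using that by (cases "s = 0") auto
      moreover have "sqrt (c + s) \<le> \<kappa> * sqrt s"
        using pos \<kappa> by (intro real_le_lsqrt) (auto simp: power_mult_distrib that)
      ultimately show ?thesis
        using pos by (simp add: field_simps)
    qed
    then show "\<Psi> (c + s) * ennreal (1 / (2 * sqrt s)) * indicator {0..} s
        \<le> ennreal (\<kappa> / (2 * sqrt (c + s))) * \<Psi> (c + s)"
      by (subst mult.commute[of "ennreal (\<kappa> / _)"], cases "\<Psi> (c + s) = 0")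
        (auto simp: indicator_def intro!: mult_left_mono ennreal_leI)
  qed
  also have "\<dots> = (\<integral>\<^sup>+s. ennreal (\<kappa> / (2 * sqrt s)) * \<Psi> s \<partial>lborel)"
    by (subst (2) nn_integral_real_affine[where c=1 and t=c]) auto
  finally show ?thesis .
qed

interpretation lborel_prod: product_sigma_finite "\<lambda>_::'i. lborel :: real measure" ..

section \<open>Uniform probability measures on cubes\<close>

abbreviation U :: "real \<Rightarrow> real measure" where
  "U r \<equiv> uniform_measure lborel {-r..r}"

lemma prob_space_U: "0 < r \<Longrightarrow> prob_space (U r)"
  by (rule prob_space_uniform_measure) auto

lemma nn_integral_U:
  assumes "0 < r" and [measurable]: "f \<in> borel_measurable borel"
  shows "(\<integral>\<^sup>+t. f t \<partial>U r) = ennreal (1 / (2 * r)) * (\<integral>\<^sup>+t. f t * indicator {-r..r} t \<partial>lborel)"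
  using assms by (subst nn_integral_uniform_measure)
    (auto simp: divide_ennreal_def mult.commute inverse_ennreal field_simps)

lemma sets_PiM_U: "sets (Pi\<^sub>M I (\<lambda>_. U r)) = sets (Pi\<^sub>M I (\<lambda>_. lborel))"
  by (rule sets_PiM_cong) auto

text \<open>Fubini, one coordinate at a time. This translates between averages over cubes, where
  Finner's inequality lives, and Lebesgue integrals, where the norms live.\<close>

lemma nn_integral_PiM_U:
  assumes "0 < r" "finite I" and "f \<in> borel_measurable (Pi\<^sub>M I (\<lambda>_. lborel))"
  shows "(\<integral>\<^sup>+x. f x \<partial>Pi\<^sub>M I (\<lambda>_. U r))
    = ennreal ((1 / (2 * r)) ^ card I) * (\<integral>\<^sup>+x. f x * indicator {x. \<forall>i\<in>I. \<bar>x i\<bar> \<le> r} x \<partial>Pi\<^sub>M I (\<lambda>_. lborel))"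
  using assms(2,3)
proof (induction I arbitrary: f rule: finite_induct)
  interpret U: product_sigma_finite "\<lambda>_. U r"
    using assms(1) by (intro product_sigma_finite.intro prob_space_imp_sigma_finite prob_space_U)
  {
    case empty
    show ?case
      by (simp add: U.nn_integral_empty lborel_prod.nn_integral_empty)
  next
    case (insert i I)
    note [measurable] = insert.prems
    have *[measurable]: "f \<in> borel_measurable (Pi\<^sub>M (insert i I) (\<lambda>_. U r))"
      using insert.prems by (simp cong: measurable_cong_sets add: sets_PiM_U)
    have ind: "indicator {x. \<forall>j\<in>insert i I. \<bar>x j\<bar> \<le> r} (x(i := t))
        = indicator {x. \<forall>j\<in>I. \<bar>x j\<bar> \<le> r} x * (indicator {-r..r} t :: ennreal)" for x and t :: real
      using insert.hyps by (auto simp: indicator_def)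
    have "(\<integral>\<^sup>+x. f x \<partial>Pi\<^sub>M (insert i I) (\<lambda>_. U r))
        = (\<integral>\<^sup>+x. (\<integral>\<^sup>+t. f (x(i := t)) \<partial>U r) \<partial>Pi\<^sub>M I (\<lambda>_. U r))"
      using insert.hyps by (intro U.product_nn_integral_insert) auto
    also have "\<dots> = (\<integral>\<^sup>+x. ennreal (1 / (2 * r)) * (\<integral>\<^sup>+t. f (x(i := t)) * indicator {-r..r} t \<partial>lborel) \<partial>Pi\<^sub>M I (\<lambda>_. U r))"
    proof (intro nn_integral_cong nn_integral_U assms(1))
      fix x assume "x \<in> space (Pi\<^sub>M I (\<lambda>_. U r))"
      then have "x \<in> space (Pi\<^sub>M I (\<lambda>_. lborel))"
        by (simp add: space_PiM)
      then show "(\<lambda>t. f (x(i := t))) \<in> borel_measurable borel"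
        by measurable
    qed
    also have "\<dots> = ennreal ((1 / (2 * r)) ^ card I) * (\<integral>\<^sup>+x. ennreal (1 / (2 * r)) *
      (\<integral>\<^sup>+t. f (x(i := t)) * indicator {-r..r} t \<partial>lborel) * indicator {x. \<forall>i\<in>I. \<bar>x i\<bar> \<le> r} x \<partial>Pi\<^sub>M I (\<lambda>_. lborel))"
      using insert.hyps by (intro insert.IH) measurable
    also have "(\<integral>\<^sup>+x. ennreal (1 / (2 * r)) *
      (\<integral>\<^sup>+t. f (x(i := t)) * indicator {-r..r} t \<partial>lborel) * indicator {x. \<forall>i\<in>I. \<bar>x i\<bar> \<le> r} x \<partial>Pi\<^sub>M I (\<lambda>_. lborel))
      = (\<integral>\<^sup>+x. ennreal (1 / (2 * r)) * (\<integral>\<^sup>+t. f (x(i := t)) *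
          indicator {x. \<forall>j\<in>insert i I. \<bar>x j\<bar> \<le> r} (x(i := t)) \<partial>lborel) \<partial>Pi\<^sub>M I (\<lambda>_. lborel))"
      unfolding ind by (intro nn_integral_cong) (auto simp: indicator_def)
    also have "\<dots> = ennreal (1 / (2 * r)) * (\<integral>\<^sup>+x. (\<integral>\<^sup>+t. f (x(i := t)) *
          indicator {x. \<forall>j\<in>insert i I. \<bar>x j\<bar> \<le> r} (x(i := t)) \<partial>lborel) \<partial>Pi\<^sub>M I (\<lambda>_. lborel))"
      unfolding ind using insert.hyps by (intro nn_integral_cmult) measurable
    also have "(\<integral>\<^sup>+x. (\<integral>\<^sup>+t. f (x(i := t)) *
          indicator {x. \<forall>j\<in>insert i I. \<bar>x j\<bar> \<le> r} (x(i := t)) \<partial>lborel) \<partial>Pi\<^sub>M I (\<lambda>_. lborel))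
      = (\<integral>\<^sup>+x. f x * indicator {x. \<forall>j\<in>insert i I. \<bar>x j\<bar> \<le> r} x \<partial>Pi\<^sub>M (insert i I) (\<lambda>_. lborel))"
      using insert.hyps
      by (intro lborel_prod.product_nn_integral_insert[symmetric]) auto
    finally show ?case
      using insert.hyps assms(1) by (simp add: mult.assoc[symmetric] ennreal_mult[symmetric])
  }
qed

text \<open>The smaller cube lies in the larger one; only the normalising volumes differ, by the
  factor c^card I.\<close>

lemma nn_integral_PiM_U_le:
  assumes "0 < c" "c \<le> 1" "0 < r" "finite I" "f \<in> borel_measurable (Pi\<^sub>M I (\<lambda>_. lborel))"
  shows "(\<integral>\<^sup>+x. f x \<partial>Pi\<^sub>M I (\<lambda>_. U (c * r))) \<le> ennreal ((1 / c) ^ card I) * (\<integral>\<^sup>+x. f x \<partial>Pi\<^sub>M I (\<lambda>_. U r))"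
proof -
  have "c * r \<le> r"
    using assms by (simp add: mult_le_cancel_right1)
  then have "(\<integral>\<^sup>+x. f x * indicator {x. \<forall>i\<in>I. \<bar>x i\<bar> \<le> c * r} x \<partial>Pi\<^sub>M I (\<lambda>_. lborel))
      \<le> (\<integral>\<^sup>+x. f x * indicator {x. \<forall>i\<in>I. \<bar>x i\<bar> \<le> r} x \<partial>Pi\<^sub>M I (\<lambda>_. lborel))"
    by (intro nn_integral_mono mult_left_mono) (auto simp: indicator_def intro: order_trans)
  then have "ennreal ((1 / (2 * (c * r))) ^ card I) *
        (\<integral>\<^sup>+x. f x * indicator {x. \<forall>i\<in>I. \<bar>x i\<bar> \<le> c * r} x \<partial>Pi\<^sub>M I (\<lambda>_. lborel))
      \<le> ennreal ((1 / (2 * (c * r))) ^ card I) *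
        (\<integral>\<^sup>+x. f x * indicator {x. \<forall>i\<in>I. \<bar>x i\<bar> \<le> r} x \<partial>Pi\<^sub>M I (\<lambda>_. lborel))"
    by (rule mult_left_mono) simp
  moreover have "(\<integral>\<^sup>+x. f x \<partial>Pi\<^sub>M I (\<lambda>_. U (c * r))) = ennreal ((1 / (2 * (c * r))) ^ card I) *
        (\<integral>\<^sup>+x. f x * indicator {x. \<forall>i\<in>I. \<bar>x i\<bar> \<le> c * r} x \<partial>Pi\<^sub>M I (\<lambda>_. lborel))"
    using assms by (intro nn_integral_PiM_U) auto
  moreover have "ennreal ((1 / c) ^ card I) * (\<integral>\<^sup>+x. f x \<partial>Pi\<^sub>M I (\<lambda>_. U r)) = ennreal ((1 / (2 * (c * r))) ^ card I) *
        (\<integral>\<^sup>+x. f x * indicator {x. \<forall>i\<in>I. \<bar>x i\<bar> \<le> r} x \<partial>Pi\<^sub>M I (\<lambda>_. lborel))"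
  proof -
    have "(1 / c) ^ card I * (1 / (2 * r)) ^ card I = (1 / (2 * (c * r))) ^ card I"
      by (simp add: power_mult_distrib[symmetric] mult.left_commute)
    then show ?thesis
      using assms by (simp add: nn_integral_PiM_U mult.assoc[symmetric] ennreal_mult[symmetric])
  qed
  ultimately show ?thesis
    by simp
qed

text \<open>By Fubini the coordinates in T contribute nothing but the volume of their cube. With S
  empty this is also used to average a constant.\<close>

lemma nn_integral_cylinder:
  fixes \<phi> :: "('i \<Rightarrow> real) \<Rightarrow> ennreal"
  assumes "S \<inter> T = {}" "finite S" "finite T" "0 \<le> r"
    and [measurable]: "\<phi> \<in> borel_measurable (Pi\<^sub>M S (\<lambda>_. lborel))"
  shows "(\<integral>\<^sup>+x. \<phi> (restrict x S) * indicator {x. \<forall>i\<in>T. \<bar>x i\<bar> \<le> r} x \<partial>Pi\<^sub>M (S \<union> T) (\<lambda>_. lborel))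
    = ennreal ((2 * r) ^ card T) * (\<integral>\<^sup>+x. \<phi> x \<partial>Pi\<^sub>M S (\<lambda>_. lborel))"
proof -
  have meas: "(\<lambda>x. \<phi> (restrict x S) * indicator {x. \<forall>i\<in>T. \<bar>x i\<bar> \<le> r} x)
      \<in> borel_measurable (Pi\<^sub>M (S \<union> T) (\<lambda>_. lborel :: real measure))"
    using assms by measurable
  have "(\<integral>\<^sup>+x. \<phi> (restrict x S) * indicator {x. \<forall>i\<in>T. \<bar>x i\<bar> \<le> r} x \<partial>Pi\<^sub>M (S \<union> T) (\<lambda>_. lborel))
     = (\<integral>\<^sup>+x. (\<integral>\<^sup>+y. \<phi> x * (\<Prod>i\<in>T. indicator {-r..r} (y i)) \<partial>Pi\<^sub>M T (\<lambda>_. lborel)) \<partial>Pi\<^sub>M S (\<lambda>_. lborel))"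
  proof (subst lborel_prod.product_nn_integral_fold[OF assms(1-3) meas], intro nn_integral_cong)
    fix x y assume "x \<in> space (Pi\<^sub>M S (\<lambda>_. lborel :: real measure))"
    then have "restrict (merge S T (x, y)) S = x"
      using assms by (auto simp: space_PiM PiE_def extensional_restrict)
    moreover have "indicator {x. \<forall>i\<in>T. \<bar>x i\<bar> \<le> r} (merge S T (x, y)) = (\<Prod>i\<in>T. indicator {-r..r} (y i) :: ennreal)"
    proof (cases "\<forall>i\<in>T. \<bar>y i\<bar> \<le> r")
      case True
      then have "(\<Prod>i\<in>T. indicator {-r..r} (y i) :: ennreal) = 1"
        by (intro prod.neutral) (auto simp: indicator_def abs_le_iff)
      then show ?thesis
        using True assms by (auto simp: indicator_def merge_def)
    next
      case False
      then obtain i where "i \<in> T" "y i \<notin> {-r..r}"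
        by (auto simp: abs_le_iff)
      then have "(\<Prod>i\<in>T. indicator {-r..r} (y i) :: ennreal) = 0"
        using assms by (intro prod_zero bexI[of _ i]) auto
      then show ?thesis
        using False assms by (auto simp: indicator_def merge_def)
    qed
    ultimately show "\<phi> (restrict (merge S T (x, y)) S) * indicator {x. \<forall>i\<in>T. \<bar>x i\<bar> \<le> r} (merge S T (x, y))
        = \<phi> x * (\<Prod>i\<in>T. indicator {-r..r} (y i))"
      by simp
  qed
  also have "\<dots> = (\<integral>\<^sup>+x. \<phi> x * ennreal ((2 * r) ^ card T) \<partial>Pi\<^sub>M S (\<lambda>_. lborel))"
  proof (intro nn_integral_cong)
    fix x
    have "(\<integral>\<^sup>+y. \<phi> x * (\<Prod>i\<in>T. indicator {-r..r} (y i)) \<partial>Pi\<^sub>M T (\<lambda>_. lborel))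
        = \<phi> x * (\<integral>\<^sup>+y. (\<Prod>i\<in>T. indicator {-r..r} (y i)) \<partial>Pi\<^sub>M T (\<lambda>_. lborel))"
      using assms by (intro nn_integral_cmult) measurable
    also have "(\<integral>\<^sup>+y. (\<Prod>i\<in>T. indicator {-r..r} (y i)) \<partial>Pi\<^sub>M T (\<lambda>_. lborel)) = ennreal ((2 * r) ^ card T)"
      using assms by (subst lborel_prod.product_nn_integral_prod) (auto simp: ennreal_power)
    finally show "(\<integral>\<^sup>+y. \<phi> x * (\<Prod>i\<in>T. indicator {-r..r} (y i)) \<partial>Pi\<^sub>M T (\<lambda>_. lborel))
        = \<phi> x * ennreal ((2 * r) ^ card T)" .
  qed
  finally show ?thesis
    by (simp add: nn_integral_multc mult.commute)
qed

section \<open>A majorant independent of one block\<close>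

text \<open>The exceptional set is enclosed in a measurable null set, and g is infinite there:
  domination becomes pointwise while the integral is unchanged. A pointwise bound can be used at
  every point moved along a sphere.\<close>

lemma completion_borel_majorant:
  fixes f :: "'a \<Rightarrow> ennreal"
  assumes "f \<in> borel_measurable (completion M)"
  obtains g where "g \<in> borel_measurable M" "\<And>x. x \<in> space M \<Longrightarrow> f x \<le> g x"
    "(\<integral>\<^sup>+x. g x \<partial>M) = (\<integral>\<^sup>+x. f x \<partial>completion M)"
proof -
  obtain g where [measurable]: "g \<in> borel_measurable M" and g: "AE x in M. f x = g x"
    using completion_ex_borel_measurable[OF assms] by auto
  then obtain N where N: "{x \<in> space M. f x \<noteq> g x} \<subseteq> N" "N \<in> null_sets M"
    by (auto elim!: AE_E)
  then have [measurable]: "N \<in> sets M"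
    by auto
  define g' where "g' x = (if x \<in> N then \<infinity> else g x)" for x
  have "AE x in M. x \<notin> N"
    using N(2) by (rule AE_not_in)
  with g have "AE x in M. g' x = f x"
    by eventually_elim (simp add: g'_def)
  then have "(\<integral>\<^sup>+x. g' x \<partial>M) = (\<integral>\<^sup>+x. f x \<partial>completion M)"
    by (simp add: nn_integral_completion cong: nn_integral_cong_AE)
  moreover have "f x \<le> g' x" if "x \<in> space M" for x
    using N(1) that by (auto simp: g'_def)
  moreover have "g' \<in> borel_measurable M"
    unfolding g'_def by measurable
  ultimately show ?thesis
    using that by blast
qed

abbreviation Lb :: "'i set \<Rightarrow> ('i \<Rightarrow> real) measure" where
  "Lb I \<equiv> Pi\<^sub>M I (\<lambda>_. lborel)"

lemma measurable_component_Lb: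
  assumes "i \<in> I"
  shows "(\<lambda>x. x i) \<in> borel_measurable (Lb I)"
  using measurable_component_singleton[OF assms, of "\<lambda>_. lborel :: real measure"] by simp

lemma measurable_cube_indicator:
  fixes r :: real
  assumes "finite T" "T \<subseteq> I"
  shows "(\<lambda>x. indicator {x. \<forall>i\<in>T. \<bar>x i\<bar> \<le> r} x :: ennreal) \<in> borel_measurable (Lb I)"
proof -
  have "Measurable.pred (Lb I) (\<lambda>x. \<bar>x i\<bar> \<le> r)" if "i \<in> T" for i
    unfolding pred_def using assms that
    by (intro borel_measurable_le borel_measurable_abs measurable_component_Lb) auto
  then have "Measurable.pred (Lb I) (\<lambda>x. \<forall>i\<in>T. \<bar>x i\<bar> \<le> r)"
    using assms by (intro pred_intros_finite) auto
  then show ?thesis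
    unfolding indicator_def by simp
qed

lemma measurable_upd_Lb:
  assumes "x \<in> space (Lb J)" "I = insert i J"
  shows "(\<lambda>t. x(i := t)) \<in> borel \<rightarrow>\<^sub>M Lb I"
  using assms by (intro measurable_fun_upd[where J=J]) auto

lemma measurable_upd_const_Lb:
  assumes "I = insert i J"
  shows "(\<lambda>x. x(i := t)) \<in> Lb J \<rightarrow>\<^sub>M Lb I"
  using assms by (intro measurable_fun_upd[where J=J]) auto

lemma measurable_override_on_Lb:
  "(\<lambda>z. override_on (fst z) (snd z) T) \<in> Lb UNIV \<Otimes>\<^sub>M Lb T \<rightarrow>\<^sub>M Lb (UNIV :: 'i set)"
proof (rule measurable_PiM_single')
  fix i :: 'i
  show "(\<lambda>z. override_on (fst z) (snd z) T i) \<in> Lb UNIV \<Otimes>\<^sub>M Lb T \<rightarrow>\<^sub>M lborel"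
    by (cases "i \<in> T") (simp_all add: override_on_def)
qed simp

text \<open>One factor in one region: V is alpha_1, the coordinates that f does not see; B is the
  block of \<open>a\<close>; e is the sign of x_a; g is a Borel majorant of |f|^p. The sign enters
  \<open>invariant\<close> because for B = {a} no rotation exchanges x_a and -x_a.\<close>

locale region_function =
  fixes f :: "('n::finite \<Rightarrow> real) \<Rightarrow> real" and V B :: "'n set" and a :: 'n and e p :: real
    and g :: "('n \<Rightarrow> real) \<Rightarrow> ennreal"
  assumes e: "\<bar>e\<bar> = 1" and V: "2 \<le> card V" and a: "a \<in> B" and B: "B = V \<or> B \<inter> V = {}"
    and invariant: "\<And>x y. (\<And>i. i \<notin> B \<Longrightarrow> x i = y i) \<Longrightarrow> (\<Sum>i\<in>B. (x i)\<^sup>2) = (\<Sum>i\<in>B. (y i)\<^sup>2) \<Longrightarrow>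
      0 \<le> e * x a \<Longrightarrow> 0 \<le> e * y a \<Longrightarrow> f (restrict x (- V)) = f (restrict y (- V))"
    and g_measurable [measurable]: "g \<in> borel_measurable (Lb (- V))"
    and majorant: "\<And>x. x \<in> space (Lb (- V)) \<Longrightarrow> ennreal (\<bar>f x\<bar> powr p) \<le> g x"
begin

text \<open>Radius of the averaging cube relative to |x|. The moved coordinates, at most n of them,
  then have square sum at most n c^2 \<sigma> = \<sigma> / n, which is at most x_a^2 when |x_a| is
  the largest coordinate.\<close>

definition c :: real where "c = 1 / real CARD('n)"

lemma c: "0 < c" "c \<le> 1"
  by (simp_all add: c_def)

definition T :: "'n set" where "T = B - {a}"

text \<open>The coordinate \<open>y a\<close> carries the squared norm \<open>\<sigma>\<close> of the point; \<open>lift\<close> recovers that point.\<close>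

definition lift :: "('n \<Rightarrow> real) \<Rightarrow> 'n \<Rightarrow> real" where
  "lift y = y(a := e * sqrt (y a - (\<Sum>i\<in>-{a}. (y i)\<^sup>2)))"

text \<open>The indicator discards the y for which the radicand in \<open>lift\<close> is negative,
  so that no point of the sphere corresponds to y.\<close>

definition k :: "('n \<Rightarrow> real) \<Rightarrow> ennreal" where
  "k y = indicator {y. (\<Sum>i\<in>-{a}. (y i)\<^sup>2) \<le> y a} y * g (restrict (lift y) (- V))"

text \<open>Since \<open>f\<close> is rotation invariant in the block \<open>B\<close>, averaging its majorant over the coordinates in
  \<open>B - {a}\<close> still gives a majorant, and one that no longer depends on these coordinates.\<close>

definition h :: "('n \<Rightarrow> real) \<Rightarrow> ennreal" where
  "h y = ennreal ((1 / (2 * (c * sqrt (y a)))) ^ card T) *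
    (\<integral>\<^sup>+v. k (override_on y v T) * indicator {v. \<forall>i\<in>T. \<bar>v i\<bar> \<le> c * sqrt (y a)} v \<partial>Lb T)"

lemma measurable_lift: "lift \<in> Lb UNIV \<rightarrow>\<^sub>M Lb UNIV"
  unfolding lift_def[abs_def] by (rule measurable_fun_upd[where J=UNIV]) auto

lemma measurable_k [measurable]: "k \<in> borel_measurable (Lb UNIV)"
proof -
  have "(\<lambda>y. restrict (lift y) (- V)) \<in> Lb UNIV \<rightarrow>\<^sub>M Lb (- V)"
    by (rule measurable_compose[OF measurable_lift measurable_restrict_subset]) simp
  then have [measurable]: "(\<lambda>y. g (restrict (lift y) (- V))) \<in> borel_measurable (Lb UNIV)"
    using g_measurable by (rule measurable_compose)
  note [measurable] = measurable_component_Lb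
  have "(\<lambda>y. \<Sum>i\<in>-{a}. (y i)\<^sup>2) \<in> borel_measurable (Lb UNIV)"
    by measurable
  then have "Measurable.pred (Lb UNIV) (\<lambda>y. (\<Sum>i\<in>-{a}. (y i)\<^sup>2) \<le> y a)"
    unfolding pred_def by (rule borel_measurable_le) measurable
  then show ?thesis
    unfolding k_def[abs_def] indicator_def by simp
qed

lemma measurable_h [measurable]: "h \<in> borel_measurable (Lb UNIV)"
proof -
  have [measurable]: "(\<lambda>z. k (override_on (fst z) (snd z) T)) \<in> borel_measurable (Lb UNIV \<Otimes>\<^sub>M Lb T)"
    by (rule measurable_compose[OF measurable_override_on_Lb measurable_k])
  interpret finite_product_sigma_finite "\<lambda>_. lborel" T
    by standard simp
  have "(\<lambda>y. \<integral>\<^sup>+v. k (override_on y v T) * indicator {v. \<forall>i\<in>T. \<bar>v i\<bar> \<le> c * sqrt (y a)} v \<partial>Lb T)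
      \<in> borel_measurable (Lb UNIV)"
  proof (rule borel_measurable_nn_integral)
    have [measurable]: "(\<lambda>z. fst z a) \<in> borel_measurable (Lb UNIV \<Otimes>\<^sub>M Lb T)"
      using measurable_compose[OF measurable_fst measurable_component_singleton[of a UNIV "\<lambda>_. lborel :: real measure"]]
      by simp
    have [measurable]: "(\<lambda>z. snd z i) \<in> borel_measurable (Lb UNIV \<Otimes>\<^sub>M Lb T)" if "i \<in> T" for i
      using measurable_compose[OF measurable_snd measurable_component_singleton[of i T "\<lambda>_. lborel :: real measure"]] that
      by simp
    have "Measurable.pred (Lb UNIV \<Otimes>\<^sub>M Lb T) (\<lambda>z. \<bar>snd z i\<bar> \<le> c * sqrt (fst z a))" if "i \<in> T" for i
      unfolding pred_def using that by (intro borel_measurable_le) measurable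
    then have "Measurable.pred (Lb UNIV \<Otimes>\<^sub>M Lb T) (\<lambda>z. \<forall>i\<in>T. \<bar>snd z i\<bar> \<le> c * sqrt (fst z a))"
      by (intro pred_intros_finite) auto
    then have [measurable]: "(\<lambda>z. indicator {v. \<forall>i\<in>T. \<bar>v i\<bar> \<le> c * sqrt (fst z a)} (snd z) :: ennreal)
        \<in> borel_measurable (Lb UNIV \<Otimes>\<^sub>M Lb T)"
      unfolding indicator_def by simp
    show "(\<lambda>(y, v). k (override_on y v T) * indicator {v. \<forall>i\<in>T. \<bar>v i\<bar> \<le> c * sqrt (y a)} v)
        \<in> borel_measurable (Lb UNIV \<Otimes>\<^sub>M Lb T)"
      unfolding split_beta' by measurable
  qed
  then show ?thesis
    unfolding h_def[abs_def] by measurable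
qed

lemma h_independent:
  assumes "i \<in> T"
  shows "h (y(i := t)) = h y"
proof -
  have "override_on (y(i := t)) v T = override_on y v T" for v
    using assms by (auto simp: override_on_def)
  moreover have "(y(i := t)) a = y a"
    using assms by (auto simp: T_def)
  ultimately show ?thesis
    by (simp add: h_def)
qed

lemma sum_split:
  fixes w :: "'n \<Rightarrow> real"
  shows "(\<Sum>i\<in>-{a}. w i) = (\<Sum>i\<in>T. w i) + (\<Sum>i\<in>-B. w i)" and "(\<Sum>i\<in>B. w i) = w a + (\<Sum>i\<in>T. w i)"
proof -
  have "- {a} = T \<union> (- B)"
    using a by (auto simp: T_def)
  then show "(\<Sum>i\<in>-{a}. w i) = (\<Sum>i\<in>T. w i) + (\<Sum>i\<in>-B. w i)"
    by (simp only:) (rule sum.union_disjoint, auto simp: T_def)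
  show "(\<Sum>i\<in>B. w i) = w a + (\<Sum>i\<in>T. w i)"
    unfolding T_def using a by (intro sum.remove) auto
qed

text \<open>The new point keeps x outside B, takes v on B - {a}, and \<open>lift\<close> solves for
  the coordinate \<open>a\<close> so that |x|^2 is preserved. Then the square sum over B is
  preserved as well, f has the same value by \<open>invariant\<close>, and the majorant is applied
  at the new point only.\<close>

lemma k_dominates:
  assumes x: "\<And>i. \<bar>x i\<bar> \<le> e * x a" and \<sigma>: "\<sigma> = (\<Sum>i\<in>UNIV. (x i)\<^sup>2)"
    and v: "\<And>i. i \<in> T \<Longrightarrow> \<bar>v i\<bar> \<le> c * sqrt \<sigma>"
  shows "ennreal (\<bar>f (restrict x (- V))\<bar> powr p) \<le> k (override_on (x(a := \<sigma>)) v T)"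
proof -
  define w where "w = override_on (x(a := \<sigma>)) v T"
  have w: "w a = \<sigma>" "\<And>i. i \<in> T \<Longrightarrow> w i = v i" "\<And>i. i \<notin> B \<Longrightarrow> w i = x i"
    using a by (auto simp: w_def T_def override_on_def)
  have x2: "(x i)\<^sup>2 \<le> (x a)\<^sup>2" for i
    using x[of i] e by (metis abs_le_square_iff abs_mult abs_of_nonneg abs_ge_zero mult_1 order_trans abs_ge_self)
  have \<sigma>_le: "\<sigma> \<le> real CARD('n) * (x a)\<^sup>2"
    unfolding \<sigma> using sum_bounded_above[of UNIV "\<lambda>i. (x i)\<^sup>2", OF x2] by simp
  have \<sigma>0: "0 \<le> \<sigma>"
    unfolding \<sigma> by (simp add: sum_nonneg)
  have v2: "(v i)\<^sup>2 \<le> c\<^sup>2 * \<sigma>" if "i \<in> T" for i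
  proof -
    have "\<bar>v i\<bar>\<^sup>2 \<le> (c * sqrt \<sigma>)\<^sup>2"
      using v[OF that] by (intro power_mono) auto
    then show ?thesis
      using \<sigma>0 by (simp add: power_mult_distrib)
  qed
  have "(\<Sum>i\<in>T. (v i)\<^sup>2) \<le> real (card T) * (c\<^sup>2 * \<sigma>)"
    using v2 by (rule sum_bounded_above)
  also have "\<dots> \<le> real CARD('n) * (c\<^sup>2 * \<sigma>)"
    using \<sigma>0 by (intro mult_right_mono) (auto simp: card_mono)
  also have "\<dots> = \<sigma> / real CARD('n)"
    by (simp add: c_def power2_eq_square field_simps)
  also have "\<dots> \<le> (x a)\<^sup>2"
    using \<sigma>_le by (simp add: field_simps)
  finally have vx: "(\<Sum>i\<in>T. (v i)\<^sup>2) \<le> (x a)\<^sup>2" .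
  have sum_w: "(\<Sum>i\<in>-{a}. (w i)\<^sup>2) = (\<Sum>i\<in>T. (v i)\<^sup>2) + (\<Sum>i\<in>-B. (x i)\<^sup>2)"
    unfolding sum_split(1) using w by simp
  have sum_x: "\<sigma> = (x a)\<^sup>2 + (\<Sum>i\<in>T. (x i)\<^sup>2) + (\<Sum>i\<in>-B. (x i)\<^sup>2)"
  proof -
    have "\<sigma> = (\<Sum>i\<in>B. (x i)\<^sup>2) + (\<Sum>i\<in>-B. (x i)\<^sup>2)"
      unfolding \<sigma> by (subst sum.union_disjoint[symmetric]) (auto intro!: sum.cong)
    then show ?thesis
      by (simp add: sum_split(2))
  qed
  \<comment> \<open>The radicand is x_a^2 plus the squares of x over T minus those of v over T,
    nonnegative by the choice of \<open>c\<close>.\<close>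
  have pos: "(\<Sum>i\<in>-{a}. (w i)\<^sup>2) \<le> w a"
    using vx sum_nonneg[of T "\<lambda>i. (x i)\<^sup>2"] unfolding sum_w w(1) sum_x by simp
  have e2: "e\<^sup>2 = 1" "e * (e * r) = r" for r
    using e by (auto simp: abs_if power2_eq_square split: if_splits)
  have "f (restrict x (- V)) = f (restrict (lift w) (- V))"
  proof (rule invariant)
    show "x i = lift w i" if "i \<notin> B" for i
      using that a w by (auto simp: lift_def)
    have "(\<Sum>i\<in>B. (lift w i)\<^sup>2) = (lift w a)\<^sup>2 + (\<Sum>i\<in>T. (lift w i)\<^sup>2)"
      by (rule sum_split(2))
    also have "(\<Sum>i\<in>T. (lift w i)\<^sup>2) = (\<Sum>i\<in>T. (v i)\<^sup>2)"
      using w by (intro sum.cong) (auto simp: lift_def T_def)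
    also have "(lift w a)\<^sup>2 = w a - (\<Sum>i\<in>-{a}. (w i)\<^sup>2)"
      using pos by (simp add: lift_def power_mult_distrib e2)
    finally show "(\<Sum>i\<in>B. (x i)\<^sup>2) = (\<Sum>i\<in>B. (lift w i)\<^sup>2)"
      by (simp add: w sum_w sum_split(2)[of "\<lambda>i. (x i)\<^sup>2"]) (simp add: sum_x)
    show "0 \<le> e * x a"
      using x[of a] by simp
    show "0 \<le> e * lift w a"
      using pos by (simp add: lift_def e2)
  qed
  also have "ennreal (\<bar>f (restrict (lift w) (- V))\<bar> powr p) \<le> g (restrict (lift w) (- V))"
    by (rule majorant) (simp add: space_PiM)
  also have "\<dots> = k w"
    using pos by (simp add: k_def)
  finally show ?thesis
    unfolding w_def .
qed

text \<open>\<open>k_dominates\<close> is averaged over the cube of the v; its left side does not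
  depend on v and equals its own average.\<close>

lemma h_dominates:
  assumes x: "\<And>i. \<bar>x i\<bar> \<le> e * x a" and \<sigma>: "\<sigma> = (\<Sum>i\<in>UNIV. (x i)\<^sup>2)" "0 < \<sigma>"
  shows "ennreal (\<bar>f (restrict x (- V))\<bar> powr p) \<le> h (x(a := \<sigma>))"
proof -
  define \<kappa> where "\<kappa> = ennreal (\<bar>f (restrict x (- V))\<bar> powr p)"
  define r where "r = c * sqrt \<sigma>"
  have r: "0 < r"
    using c \<sigma> by (simp add: r_def)
  have "\<kappa> * ennreal ((2 * r) ^ card T) = (\<integral>\<^sup>+v. \<kappa> * indicator {v. \<forall>i\<in>T. \<bar>v i\<bar> \<le> r} v \<partial>Lb ({} \<union> T))"
    using nn_integral_cylinder[of "{}" T r "\<lambda>_. \<kappa>"] r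
    by (simp add: lborel_prod.nn_integral_empty mult.commute del: nn_integral_const)
  also have "\<dots> \<le> (\<integral>\<^sup>+v. k (override_on (x(a := \<sigma>)) v T) * indicator {v. \<forall>i\<in>T. \<bar>v i\<bar> \<le> r} v \<partial>Lb T)"
    using k_dominates[OF x \<sigma>(1)] unfolding \<kappa>_def r_def
    by (auto intro!: nn_integral_mono simp: indicator_def)
  finally have "ennreal ((1 / (2 * r)) ^ card T) * (\<kappa> * ennreal ((2 * r) ^ card T)) \<le> h (x(a := \<sigma>))"
    unfolding h_def r_def by (simp add: mult_left_mono)
  moreover have "ennreal ((1 / (2 * r)) ^ card T) * (\<kappa> * ennreal ((2 * r) ^ card T)) = \<kappa>"
  proof -
    have "(1 / (2 * r)) ^ card T * (2 * r) ^ card T = (1 / (2 * r) * (2 * r)) ^ card T"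
      by (rule power_mult_distrib[symmetric])
    also have "\<dots> = 1"
      using r by simp
    finally have "ennreal ((1 / (2 * r)) ^ card T * (2 * r) ^ card T) = 1"
      by (simp only: ennreal_1)
    moreover have "ennreal ((1 / (2 * r)) ^ card T * (2 * r) ^ card T)
        = ennreal ((1 / (2 * r)) ^ card T) * ennreal ((2 * r) ^ card T)"
      using r by (intro ennreal_mult) auto
    ultimately show ?thesis
      by (simp only: mult.left_commute[of _ \<kappa>] mult_1_right)
  qed
  ultimately show ?thesis
    by (simp add: \<kappa>_def)
qed

section \<open>Integrals of the averaged majorant over a sphere\<close>

lemma measurable_g_restrict:
  assumes "- V \<subseteq> I"
  shows "(\<lambda>x. g (restrict x (- V))) \<in> borel_measurable (Lb I)"
  by (rule measurable_compose[OF measurable_restrict_subset[OF assms] g_measurable])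

text \<open>For \<open>a\<close> in V the majorant does not see the recovered coordinate, so only
  the volume of the cube in V - {a} appears. The factor pi gives a common bound with the case of
  \<open>a\<close> outside V.\<close>

lemma nn_integral_k_same_block:
  assumes "a \<in> V" "0 \<le> r"
  shows "(\<integral>\<^sup>+x. k (x(a := \<sigma>)) * indicator {x. \<forall>i\<in>-{a}. \<bar>x i\<bar> \<le> r} x \<partial>Lb (-{a}))
    \<le> ennreal (pi * (2 * r) ^ (card V - 1)) * (\<integral>\<^sup>+x. g x \<partial>Lb (- V))"
proof -
  have I: "- {a} = - V \<union> (V - {a})"
    using assms by auto
  have "(\<integral>\<^sup>+x. k (x(a := \<sigma>)) * indicator {x. \<forall>i\<in>-{a}. \<bar>x i\<bar> \<le> r} x \<partial>Lb (-{a}))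
    \<le> (\<integral>\<^sup>+x. g (restrict x (- V)) * indicator {x. \<forall>i\<in>V - {a}. \<bar>x i\<bar> \<le> r} x \<partial>Lb (-{a}))"
  proof (intro nn_integral_mono mult_mono)
    fix x
    have "restrict (lift (x(a := \<sigma>))) (- V) = restrict x (- V)"
      using assms by (auto simp: lift_def restrict_def)
    then show "k (x(a := \<sigma>)) \<le> g (restrict x (- V))"
      by (simp add: k_def indicator_def)
  qed (auto simp: indicator_def)
  also have "\<dots> = ennreal ((2 * r) ^ (card V - 1)) * (\<integral>\<^sup>+x. g x \<partial>Lb (- V))"
    unfolding I using assms by (subst nn_integral_cylinder) auto
  also have "\<dots> \<le> ennreal (pi * (2 * r) ^ (card V - 1)) * (\<integral>\<^sup>+x. g x \<partial>Lb (- V))"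
  proof (intro mult_right_mono ennreal_leI)
    show "(2 * r) ^ (card V - 1) \<le> pi * (2 * r) ^ (card V - 1)"
      using pi_ge_two mult_right_mono[of 1 pi "(2 * r) ^ (card V - 1)"] assms by simp
  qed simp
  finally show ?thesis .
qed

text \<open>Two of the coordinates in \<open>V\<close> enter \<open>k\<close> only through the sum of their squares, and integrating
  them out in polar coordinates produces the missing integration over the coordinate \<open>a\<close>.\<close>

lemma nn_integral_k_other_block:
  assumes "a \<notin> V" and r: "0 < r"
  shows "(\<integral>\<^sup>+x. k (x(a := r\<^sup>2)) * indicator {x. \<forall>i\<in>-{a}. \<bar>x i\<bar> \<le> r} x \<partial>Lb (-{a}))
    \<le> ennreal (pi * (2 * r) ^ (card V - 1)) * (\<integral>\<^sup>+x. g x \<partial>Lb (- V))"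
proof -
  obtain b d where bd: "b \<in> V" "d \<in> V" "b \<noteq> d"
    using V by (metis card_le_Suc0_iff_eq finite not_less_eq_eq numeral_2_eq_2)
  define J where "J = - {a, b, d}"
  have abd: "a \<noteq> b" "a \<noteq> d"
    using assms bd by auto
  have I: "- {a} = insert b (insert d J)" and J: "b \<notin> insert d J" "d \<notin> J" "a \<notin> J" "J - {a} = J"
    using bd abd by (auto simp: J_def)
  have J': "insert a J = - V \<union> (V - {b, d})"
    using assms bd by (auto simp: J_def)
  \<comment> \<open>Only the cube constraints in V - {b, d} are kept. Coordinates outside V will be
    integrated with g over the whole space, and b, d over the whole plane, where \<open>k\<close>
    itself confines them to a disc.\<close>
  define F where "F x = k (x(a := r\<^sup>2)) * indicator {x. \<forall>i\<in>V - {b, d}. \<bar>x i\<bar> \<le> r} x" for x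
  have F: "F \<in> borel_measurable (Lb (-{a}))"
    unfolding F_def[abs_def]
    by (intro borel_measurable_times_ennreal measurable_cube_indicator measurable_compose[OF measurable_upd_const_Lb measurable_k])
      (use assms in auto)
  then have F1: "F \<in> borel_measurable (Lb (insert b (insert d J)))"
    by (simp only: I)
  have F2: "(\<lambda>x. \<integral>\<^sup>+t. F (x(b := t)) \<partial>lborel) \<in> borel_measurable (Lb (insert d J))"
  proof (rule lborel.borel_measurable_nn_integral)
    have "(\<lambda>(x, t). x(b := t)) \<in> Lb (insert d J) \<Otimes>\<^sub>M lborel \<rightarrow>\<^sub>M Lb (insert b (insert d J))"
      by measurable
    from measurable_compose[OF this F1] show "(\<lambda>(x, t). F (x(b := t))) \<in> borel_measurable (Lb (insert d J) \<Otimes>\<^sub>M lborel)"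
      by (simp add: split_beta' del: fun_upd_apply)
  qed
  have fibre: "(\<integral>\<^sup>+s. (\<integral>\<^sup>+t. F (x(d := s, b := t)) \<partial>lborel) \<partial>lborel)
      \<le> ennreal (2 * pi * r) * (\<integral>\<^sup>+v. g (restrict (x(a := v)) (- V)) *
          indicator {x. \<forall>i\<in>V - {b, d}. \<bar>x i\<bar> \<le> r} (x(a := v)) \<partial>lborel)"
    if x: "x \<in> space (Lb J)" for x
  proof -
    \<comment> \<open>K - (s^2 + t^2) is the square of the recovered coordinate \<open>a\<close>.
      With the coordinates in J fixed, it depends on s and t through s^2 + t^2 alone, so
      \<open>nn_integral_sphere_fibre\<close> applies with \<rho> = r.\<close>
    define K where "K = r\<^sup>2 - (\<Sum>i\<in>J. (x i)\<^sup>2)"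
    define \<theta> :: ennreal where "\<theta> = indicator {x. \<forall>i\<in>V - {b, d}. \<bar>x i\<bar> \<le> r} x"
    define \<phi> where "\<phi> v = g (restrict (x(a := v)) (- V))" for v
    have \<phi>: "\<phi> \<in> borel_measurable borel"
      unfolding \<phi>_def using measurable_compose[OF measurable_upd_Lb[OF x refl, of a] measurable_g_restrict]
      by (auto simp: J')
    have K: "K \<le> r\<^sup>2"
      by (simp add: K_def sum_nonneg)
    have F_eq: "F (x(d := s, b := t)) = \<theta> * (indicator {..K} (s\<^sup>2 + t\<^sup>2) * \<phi> (e * sqrt (K - (s\<^sup>2 + t\<^sup>2))))" for s t
    proof -
      define y where "y = x(d := s, b := t, a := r\<^sup>2)"
      have "(\<Sum>i\<in>-{a}. (y i)\<^sup>2) = t\<^sup>2 + (s\<^sup>2 + (\<Sum>i\<in>J. (y i)\<^sup>2))"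
        unfolding I using J bd abd by (simp add: y_def)
      also have "(\<Sum>i\<in>J. (y i)\<^sup>2) = (\<Sum>i\<in>J. (x i)\<^sup>2)"
        by (intro sum.cong) (auto simp: J_def y_def)
      finally have sum_y: "(\<Sum>i\<in>-{a}. (y i)\<^sup>2) = t\<^sup>2 + (s\<^sup>2 + (\<Sum>i\<in>J. (x i)\<^sup>2))" .
      have "restrict (lift y) (- V) = restrict (x(a := e * sqrt (K - (s\<^sup>2 + t\<^sup>2)))) (- V)"
        using bd abd unfolding lift_def sum_y by (auto simp: y_def K_def algebra_simps restrict_def)
      moreover have "(\<Sum>i\<in>-{a}. (y i)\<^sup>2) \<le> y a \<longleftrightarrow> s\<^sup>2 + t\<^sup>2 \<le> K"
        unfolding sum_y K_def by (auto simp: y_def)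
      ultimately have "k y = indicator {..K} (s\<^sup>2 + t\<^sup>2) * \<phi> (e * sqrt (K - (s\<^sup>2 + t\<^sup>2)))"
        by (simp add: k_def \<phi>_def indicator_def)
      moreover have "indicator {x. \<forall>i\<in>V - {b, d}. \<bar>x i\<bar> \<le> r} (x(d := s, b := t)) = \<theta>"
        by (auto simp: \<theta>_def indicator_def)
      ultimately show ?thesis
        by (simp add: F_def y_def mult.commute)
    qed
    have \<theta>: "\<theta> = 0 \<or> \<theta> = 1"
      by (auto simp: \<theta>_def indicator_def)
    have "(\<integral>\<^sup>+s. (\<integral>\<^sup>+t. F (x(d := s, b := t)) \<partial>lborel) \<partial>lborel) =
      \<theta> * (\<integral>\<^sup>+s. (\<integral>\<^sup>+t. indicator {..K} (s\<^sup>2 + t\<^sup>2) * \<phi> (e * sqrt (K - (s\<^sup>2 + t\<^sup>2))) \<partial>lborel) \<partial>lborel)"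
      unfolding F_eq using \<theta> by auto
    also have "\<dots> \<le> \<theta> * (ennreal (2 * pi * r) * (\<integral>\<^sup>+v. \<phi> v \<partial>lborel))"
      using r by (intro mult_left_mono nn_integral_sphere_fibre[OF \<phi> e _ K]) auto
    also have "\<dots> = ennreal (2 * pi * r) * (\<integral>\<^sup>+v. \<phi> v * \<theta> \<partial>lborel)"
      using \<theta> by auto
    also have "(\<integral>\<^sup>+v. \<phi> v * \<theta> \<partial>lborel) = (\<integral>\<^sup>+v. g (restrict (x(a := v)) (- V)) *
          indicator {x. \<forall>i\<in>V - {b, d}. \<bar>x i\<bar> \<le> r} (x(a := v)) \<partial>lborel)"
      using assms by (intro nn_integral_cong) (auto simp: \<phi>_def \<theta>_def indicator_def)
    finally show ?thesis .
  qed
  have G: "(\<lambda>x. g (restrict x (- V)) * indicator {x. \<forall>i\<in>V - {b, d}. \<bar>x i\<bar> \<le> r} x) \<in> borel_measurable (Lb (insert a J))"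
    unfolding J' by (intro borel_measurable_times_ennreal measurable_cube_indicator measurable_g_restrict) auto
  have G2: "(\<lambda>x. \<integral>\<^sup>+v. g (restrict (x(a := v)) (- V)) *
          indicator {x. \<forall>i\<in>V - {b, d}. \<bar>x i\<bar> \<le> r} (x(a := v)) \<partial>lborel) \<in> borel_measurable (Lb J)"
  proof (rule lborel.borel_measurable_nn_integral)
    have "(\<lambda>(x, t). x(a := t)) \<in> Lb J \<Otimes>\<^sub>M lborel \<rightarrow>\<^sub>M Lb (insert a J)"
      by measurable
    from measurable_compose[OF this G]
    show "(\<lambda>(x, v). g (restrict (x(a := v)) (- V)) * indicator {x. \<forall>i\<in>V - {b, d}. \<bar>x i\<bar> \<le> r} (x(a := v)))
        \<in> borel_measurable (Lb J \<Otimes>\<^sub>M lborel)"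
      by (simp add: split_beta' del: fun_upd_apply)
  qed
  have "(\<integral>\<^sup>+x. k (x(a := r\<^sup>2)) * indicator {x. \<forall>i\<in>-{a}. \<bar>x i\<bar> \<le> r} x \<partial>Lb (-{a})) \<le> (\<integral>\<^sup>+x. F x \<partial>Lb (-{a}))"
    unfolding F_def using assms by (intro nn_integral_mono mult_left_mono) (auto simp: indicator_def)
  also have "\<dots> = (\<integral>\<^sup>+x. (\<integral>\<^sup>+t. F (x(b := t)) \<partial>lborel) \<partial>Lb (insert d J))"
    unfolding I using J by (intro lborel_prod.product_nn_integral_insert F1) auto
  also have "\<dots> = (\<integral>\<^sup>+x. (\<integral>\<^sup>+s. (\<integral>\<^sup>+t. F (x(d := s, b := t)) \<partial>lborel) \<partial>lborel) \<partial>Lb J)"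
    using J by (intro lborel_prod.product_nn_integral_insert F2) auto
  also have "\<dots> \<le> (\<integral>\<^sup>+x. ennreal (2 * pi * r) * (\<integral>\<^sup>+v. g (restrict (x(a := v)) (- V)) *
          indicator {x. \<forall>i\<in>V - {b, d}. \<bar>x i\<bar> \<le> r} (x(a := v)) \<partial>lborel) \<partial>Lb J)"
    by (intro nn_integral_mono fibre)
  also have "\<dots> = ennreal (2 * pi * r) * (\<integral>\<^sup>+x. (\<integral>\<^sup>+v. g (restrict (x(a := v)) (- V)) *
          indicator {x. \<forall>i\<in>V - {b, d}. \<bar>x i\<bar> \<le> r} (x(a := v)) \<partial>lborel) \<partial>Lb J)"
    by (rule nn_integral_cmult[OF G2])
  also have "(\<integral>\<^sup>+x. (\<integral>\<^sup>+v. g (restrict (x(a := v)) (- V)) *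
          indicator {x. \<forall>i\<in>V - {b, d}. \<bar>x i\<bar> \<le> r} (x(a := v)) \<partial>lborel) \<partial>Lb J)
      = (\<integral>\<^sup>+x. g (restrict x (- V)) * indicator {x. \<forall>i\<in>V - {b, d}. \<bar>x i\<bar> \<le> r} x \<partial>Lb (insert a J))"
    using J by (intro lborel_prod.product_nn_integral_insert[symmetric] G) auto
  also have "\<dots> = ennreal ((2 * r) ^ card (V - {b, d})) * (\<integral>\<^sup>+x. g x \<partial>Lb (- V))"
    unfolding J' using r by (intro nn_integral_cylinder) auto
  also have "ennreal (2 * pi * r) * (ennreal ((2 * r) ^ card (V - {b, d})) * (\<integral>\<^sup>+x. g x \<partial>Lb (- V)))
      = ennreal (pi * (2 * r) ^ (card V - 1)) * (\<integral>\<^sup>+x. g x \<partial>Lb (- V))"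
  proof -
    \<comment> \<open>The 2 pi r of the sphere fibre and the (2 r)^(card V - 2) of the remaining
      cube combine to pi (2 r)^(card V - 1).\<close>
    have "card V - 1 = Suc (card (V - {b, d}))"
      using V bd by (simp add: card_Diff_subset)
    then have "pi * (2 * r) ^ (card V - 1) = (2 * pi * r) * (2 * r) ^ card (V - {b, d})"
      by simp
    moreover have "ennreal ((2 * pi * r) * (2 * r) ^ card (V - {b, d}))
        = ennreal (2 * pi * r) * ennreal ((2 * r) ^ card (V - {b, d}))"
      using r by (intro ennreal_mult) auto
    ultimately show ?thesis
      by (simp only: mult.assoc)
  qed
  finally show ?thesis .
qed

text \<open>Normalisation contributes (2 r)^-(n - 1) and either block case (2 r)^(card V - 1), which
  leaves r^(card V - n); the factor 2^(card V - n), at most 1, is dropped.\<close>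

lemma nn_integral_k:
  assumes r: "0 < r"
  shows "(\<integral>\<^sup>+x. k (x(a := r\<^sup>2)) \<partial>Pi\<^sub>M (-{a}) (\<lambda>_. U r))
    \<le> ennreal (pi * r powr (real (card V) - real CARD('n))) * (\<integral>\<^sup>+x. g x \<partial>Lb (- V))"
proof -
  define n where "n = CARD('n)"
  have n: "card (- {a}) = n - 1" "card V \<le> n" "1 \<le> card V"
    using V by (metis Compl_eq_Diff_UNIV UNIV_I card_Diff_singleton n_def, auto simp: n_def card_mono)
  have "(\<lambda>x. k (x(a := r\<^sup>2))) \<in> borel_measurable (Lb (-{a}))"
    using measurable_compose[OF measurable_upd_const_Lb measurable_k, of a "-{a}" "r\<^sup>2"] by auto
  then have "(\<integral>\<^sup>+x. k (x(a := r\<^sup>2)) \<partial>Pi\<^sub>M (-{a}) (\<lambda>_. U r)) = ennreal ((1 / (2 * r)) ^ (n - 1)) *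
      (\<integral>\<^sup>+x. k (x(a := r\<^sup>2)) * indicator {x. \<forall>i\<in>-{a}. \<bar>x i\<bar> \<le> r} x \<partial>Lb (-{a}))"
    using r n(1) by (subst nn_integral_PiM_U) auto
  also have "\<dots> \<le> ennreal ((1 / (2 * r)) ^ (n - 1)) * (ennreal (pi * (2 * r) ^ (card V - 1)) * (\<integral>\<^sup>+x. g x \<partial>Lb (- V)))"
    using r nn_integral_k_same_block[of r "r\<^sup>2"] nn_integral_k_other_block[of r]
    by (intro mult_left_mono) auto
  also have "\<dots> = ennreal ((1 / (2 * r)) ^ (n - 1) * (pi * (2 * r) ^ (card V - 1))) * (\<integral>\<^sup>+x. g x \<partial>Lb (- V))"
    using r by (subst ennreal_mult) (auto simp: mult.assoc)
  also have "\<dots> \<le> ennreal (pi * r powr (real (card V) - real n)) * (\<integral>\<^sup>+x. g x \<partial>Lb (- V))"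
  proof (intro mult_right_mono ennreal_leI)
    have "(1 / (2 * r)) ^ (n - 1) * (2 * r) ^ (card V - 1) = (1 / (2 * r)) ^ (n - card V)"
    proof -
      have "(1 / (2 * r)) ^ (n - 1) = (1 / (2 * r)) ^ (n - card V) * (1 / (2 * r)) ^ (card V - 1)"
      proof -
        have "n - 1 = (n - card V) + (card V - 1)"
          using n by simp
        then show ?thesis
          by (simp only: power_add)
      qed
      moreover have "(1 / (2 * r)) ^ (card V - 1) * (2 * r) ^ (card V - 1) = 1"
        using r by (simp only: power_mult_distrib[symmetric]) simp
      ultimately show ?thesis
        by (simp only: mult.assoc mult_1_right)
    qed
    also have "\<dots> \<le> (1 / r) ^ (n - card V)"
      using r by (intro power_mono) (auto simp: field_simps)
    also have "\<dots> = r powr (real (card V) - real n)"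
    proof -
      have "real (card V) - real n = - real (n - card V)"
        using n by simp
      then have "r powr (real (card V) - real n) = inverse (r ^ (n - card V))"
        using r by (simp only: powr_minus powr_realpow)
      then show ?thesis
        by (simp only: power_one_over inverse_eq_divide)
    qed
    finally have "pi * ((1 / (2 * r)) ^ (n - 1) * (2 * r) ^ (card V - 1)) \<le> pi * r powr (real (card V) - real n)"
      by (intro mult_left_mono) auto
    then show "(1 / (2 * r)) ^ (n - 1) * (pi * (2 * r) ^ (card V - 1)) \<le> pi * r powr (real (card V) - real n)"
      by (simp only: mult.left_commute)
  qed simp
  finally show ?thesis
    by (simp add: n_def)
qed

text \<open>At norm r, \<open>h\<close> is the average of \<open>k\<close> over the cube of radius c
  r in T. Enlarging this cube to radius r costs (1 / c)^card T, at most n^n; the average over T then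
  joins the average over the remaining coordinates to the one in
  \<open>nn_integral_k\<close>.\<close>

lemma nn_integral_h:
  assumes r: "0 < r"
  shows "(\<integral>\<^sup>+x. h (x(a := r\<^sup>2)) \<partial>Pi\<^sub>M (-{a}) (\<lambda>_. U r))
    \<le> ennreal (pi * real CARD('n) ^ CARD('n) * r powr (real (card V) - real CARD('n))) * (\<integral>\<^sup>+x. g x \<partial>Lb (- V))"
proof -
  have I: "- {a} = - B \<union> T" "- B \<inter> T = {}"
    using a by (auto simp: T_def)
  interpret U: product_sigma_finite "\<lambda>_. U r"
    using r by (intro product_sigma_finite.intro prob_space_imp_sigma_finite prob_space_U)
  interpret PT: prob_space "Pi\<^sub>M T (\<lambda>_. U r)"
    using r by (intro prob_space_PiM prob_space_U)
  define H where "H x = (\<integral>\<^sup>+v. k (override_on (x(a := r\<^sup>2)) v T) \<partial>Pi\<^sub>M T (\<lambda>_. U (c * r)))" for x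
  have k_T: "(\<lambda>v. k (override_on y v T)) \<in> borel_measurable (Lb T)" for y
    by (rule measurable_compose[OF measurable_compose[OF measurable_Pair1' measurable_override_on_Lb, simplified] measurable_k])
      (simp add: space_PiM)
  have h_eq: "h (x(a := r\<^sup>2)) = H x" for x
    unfolding H_def h_def using r c by (subst nn_integral_PiM_U) (auto simp: k_T)
  have upd: "(merge (- B) T (x, v))(a := r\<^sup>2) = override_on (x(a := r\<^sup>2)) v T" for x v
    using a by (auto simp: fun_eq_iff merge_def override_on_def T_def)
  have H_merge: "H (merge (- B) T (x, v)) = H x" for x v
  proof -
    have "override_on ((merge (- B) T (x, v))(a := r\<^sup>2)) w T = override_on (x(a := r\<^sup>2)) w T" for w
      unfolding upd by (auto simp: override_on_def)
    then show ?thesis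
      by (simp add: H_def)
  qed
  have kU: "(\<lambda>x. k (x(a := r\<^sup>2))) \<in> borel_measurable (Pi\<^sub>M (- B \<union> T) (\<lambda>_. U r))"
    and hU: "(\<lambda>x. h (x(a := r\<^sup>2))) \<in> borel_measurable (Pi\<^sub>M (- B \<union> T) (\<lambda>_. U r))"
    using measurable_compose[OF measurable_upd_const_Lb measurable_k, of a "-{a}" "r\<^sup>2"]
      measurable_compose[OF measurable_upd_const_Lb measurable_h, of a "-{a}" "r\<^sup>2"]
    unfolding I(1)[symmetric] by (auto simp: measurable_cong_sets[OF sets_PiM_U refl])
  have "(\<integral>\<^sup>+x. h (x(a := r\<^sup>2)) \<partial>Pi\<^sub>M (-{a}) (\<lambda>_. U r))
      = (\<integral>\<^sup>+x. (\<integral>\<^sup>+v. h ((merge (- B) T (x, v))(a := r\<^sup>2)) \<partial>Pi\<^sub>M T (\<lambda>_. U r)) \<partial>Pi\<^sub>M (- B) (\<lambda>_. U r))"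
    unfolding I(1) using I(2) hU by (intro U.product_nn_integral_fold) auto
  also have "\<dots> = (\<integral>\<^sup>+x. H x \<partial>Pi\<^sub>M (- B) (\<lambda>_. U r))"
    by (simp add: h_eq H_merge PT.emeasure_space_1)
  also have "\<dots> \<le> (\<integral>\<^sup>+x. ennreal ((1 / c) ^ card T) *
      (\<integral>\<^sup>+v. k ((merge (- B) T (x, v))(a := r\<^sup>2)) \<partial>Pi\<^sub>M T (\<lambda>_. U r)) \<partial>Pi\<^sub>M (- B) (\<lambda>_. U r))"
    unfolding H_def upd using r c k_T by (intro nn_integral_mono nn_integral_PiM_U_le) auto
  also have "\<dots> = ennreal ((1 / c) ^ card T) * (\<integral>\<^sup>+x.
      (\<integral>\<^sup>+v. k ((merge (- B) T (x, v))(a := r\<^sup>2)) \<partial>Pi\<^sub>M T (\<lambda>_. U r)) \<partial>Pi\<^sub>M (- B) (\<lambda>_. U r))"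
  proof (intro nn_integral_cmult PT.borel_measurable_nn_integral)
    show "(\<lambda>(x, v). k ((merge (- B) T (x, v))(a := r\<^sup>2)))
        \<in> borel_measurable (Pi\<^sub>M (- B) (\<lambda>_. U r) \<Otimes>\<^sub>M Pi\<^sub>M T (\<lambda>_. U r))"
      using measurable_compose[OF measurable_merge kU] by (simp add: split_beta' del: fun_upd_apply)
  qed
  also have "(\<integral>\<^sup>+x. (\<integral>\<^sup>+v. k ((merge (- B) T (x, v))(a := r\<^sup>2)) \<partial>Pi\<^sub>M T (\<lambda>_. U r)) \<partial>Pi\<^sub>M (- B) (\<lambda>_. U r))
      = (\<integral>\<^sup>+x. k (x(a := r\<^sup>2)) \<partial>Pi\<^sub>M (-{a}) (\<lambda>_. U r))"
    unfolding I(1) using I(2) kU by (intro U.product_nn_integral_fold[symmetric]) auto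
  also have "ennreal ((1 / c) ^ card T) * \<dots> \<le> ennreal (real CARD('n) ^ CARD('n)) *
      (ennreal (pi * r powr (real (card V) - real CARD('n))) * (\<integral>\<^sup>+x. g x \<partial>Lb (- V)))"
  proof (intro mult_mono ennreal_leI nn_integral_k r)
    show "(1 / c) ^ card T \<le> real CARD('n) ^ CARD('n)"
      by (simp add: c_def card_mono power_increasing)
  qed auto
  also have "\<dots> = ennreal (pi * real CARD('n) ^ CARD('n) * r powr (real (card V) - real CARD('n))) * (\<integral>\<^sup>+x. g x \<partial>Lb (- V))"
  proof -
    have "pi * real CARD('n) ^ CARD('n) * r powr (real (card V) - real CARD('n))
        = real CARD('n) ^ CARD('n) * (pi * r powr (real (card V) - real CARD('n)))"
      by simp
    also have "ennreal \<dots> = ennreal (real CARD('n) ^ CARD('n)) * ennreal (pi * r powr (real (card V) - real CARD('n)))"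
      by (intro ennreal_mult) auto
    finally show ?thesis
      by (simp only: mult.assoc)
  qed
  finally show ?thesis .
qed

end

section \<open>Blocks, exponents and rotations\<close>

lemma transpose_L: "k \<noteq> l \<Longrightarrow> transpose (L k l) = - L k l"
  unfolding L_def transpose_def by (simp add: vec_eq_iff)

lemma L_support: "L k l $ i $ j \<noteq> 0 \<Longrightarrow> i \<in> {k, l} \<and> j \<in> {k, l}"
  unfolding L_def by (simp split: if_splits)

text \<open>The skew matrices supported in \<beta> x \<beta> form a Lie subalgebra containing the
  generators, hence contain the algebra they generate.\<close>

lemma so_index_support:
  fixes M :: "real ^ 'n::{finite,linorder} ^ 'n::{finite,linorder}"
  assumes "M \<in> so_index \<beta>" "M $ k $ l \<noteq> 0"
  shows "k \<in> \<beta> \<and> l \<in> \<beta>"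
proof -
  define S :: "(real ^ 'n::{finite,linorder} ^ 'n::{finite,linorder}) set" where "S = {M \<in> so. \<forall>k l. M $ k $ l \<noteq> 0 \<longrightarrow> k \<in> \<beta> \<and> l \<in> \<beta>}"
  have prod: "(X ** Y) $ k $ l \<noteq> 0 \<longrightarrow> k \<in> \<beta> \<and> l \<in> \<beta>" if "X \<in> S" "Y \<in> S" for X Y k l
  proof -
    have "(X ** Y) $ k $ l = (\<Sum>i\<in>UNIV. X $ k $ i * Y $ i $ l)"
      by (simp add: matrix_matrix_mult_def)
    moreover have "(\<Sum>i\<in>UNIV. X $ k $ i * Y $ i $ l) = 0" if "k \<notin> \<beta> \<or> l \<notin> \<beta>"
      using that \<open>X \<in> S\<close> \<open>Y \<in> S\<close> by (intro sum.neutral) (auto simp: S_def)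
    ultimately show ?thesis
      by auto
  qed
  have "lie_subalgebra S"
    unfolding lie_subalgebra_def
  proof (intro conjI ballI)
    have neg: "(- X) ** (- Y) = X ** Y" for X Y :: "real ^ 'n::{finite,linorder} ^ 'n::{finite,linorder}"
      by (simp add: matrix_matrix_mult_def vec_eq_iff)
    have tr: "transpose (X + Y) = transpose X + transpose Y" "transpose (r *\<^sub>R X) = r *\<^sub>R transpose X"
      "transpose (X - Y) = transpose X - transpose Y"
      for X Y :: "real ^ 'n::{finite,linorder} ^ 'n::{finite,linorder}" and r
      by (simp_all add: transpose_def vec_eq_iff)
    show "subspace S"
    proof (rule subspaceI)
      show "0 \<in> S"
        by (auto simp: S_def so_def transpose_def vec_eq_iff)
      show "X + Y \<in> S" if "X \<in> S" "Y \<in> S" for X Y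
      proof -
        have "(X + Y) $ k $ l \<noteq> 0 \<Longrightarrow> X $ k $ l \<noteq> 0 \<or> Y $ k $ l \<noteq> 0" for k l
          by auto
        then show ?thesis
          using that unfolding S_def so_def mem_Collect_eq tr by (metis minus_add_distrib)
      qed
      show "r *\<^sub>R X \<in> S" if "X \<in> S" for r X
        using that by (auto simp: S_def so_def tr)
    qed
    show "S \<subseteq> so"
      by (auto simp: S_def)
    fix X Y assume XY: "X \<in> S" "Y \<in> S"
    then have "transpose (bracket X Y) = - bracket X Y"
      by (auto simp: S_def so_def bracket_def tr matrix_transpose_mul neg)
    moreover have "bracket X Y $ k $ l \<noteq> 0 \<longrightarrow> k \<in> \<beta> \<and> l \<in> \<beta>" for k l
      using prod[OF XY, of k l] prod[OF XY(2,1), of k l] by (auto simp: bracket_def)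
    ultimately show "bracket X Y \<in> S"
      by (simp add: S_def so_def)
  qed
  moreover have "{L k l | k l. k < l \<and> k \<in> \<beta> \<and> l \<in> \<beta>} \<subseteq> S"
  proof -
    have "L k l \<in> S" if "k < l" "k \<in> \<beta>" "l \<in> \<beta>" for k l
    proof -
      have "transpose (L k l) = - L k l"
        using that(1) by (intro transpose_L) simp
      moreover have "L k l $ i $ j \<noteq> 0 \<longrightarrow> i \<in> \<beta> \<and> j \<in> \<beta>" for i j
        using that by (auto dest: L_support)
      ultimately show ?thesis
        unfolding S_def so_def by blast
    qed
    then show ?thesis
      by blast
  qed
  ultimately have "so_index \<beta> \<subseteq> S"
    unfolding so_index_def lie_generated_def by (intro hull_minimal)
  then show ?thesis
    using assms by (auto simp: S_def)
qed

text \<open>For a labeling this is the class of \<open>a\<close> in the partition of the coordinates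
  into the \<alpha> i and singletons.\<close>

definition block :: "nat \<Rightarrow> (nat \<Rightarrow> 'n set) \<Rightarrow> 'n \<Rightarrow> 'n set" where
  "block N \<alpha> a = {b. b = a \<or> (\<exists>i\<in>{1..N}. a \<in> \<alpha> i \<and> b \<in> \<alpha> i)}"

lemma block_eq:
  assumes "labeling A N \<alpha>" "i \<in> {1..N}" "a \<in> \<alpha> i"
  shows "block N \<alpha> a = \<alpha> i"
proof -
  have "j = i" if "j \<in> {1..N}" "a \<in> \<alpha> j" for j
  proof (rule ccontr)
    assume "j \<noteq> i"
    then have "disjnt (\<alpha> j) (\<alpha> i)"
      using assms that by (simp add: labeling_def)
    then show False
      using assms that by (auto simp: disjnt_def)
  qed
  then show ?thesis
    using assms(2,3) unfolding block_def by blast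
qed

lemma block_singleton: "(\<And>i. i \<in> {1..N} \<Longrightarrow> a \<notin> \<alpha> i) \<Longrightarrow> block N \<alpha> a = {a}"
  unfolding block_def by blast

text \<open>\<alpha> 1 is the longest index set and, having at least two elements, also exceeds a
  singleton block.\<close>

lemma card_block_le:
  assumes "labeling A N \<alpha>"
  shows "card (block N \<alpha> a) \<le> card (\<alpha> 1)"
proof (cases "\<exists>i\<in>{1..N}. a \<in> \<alpha> i")
  case True
  then obtain i where "i \<in> {1..N}" "a \<in> \<alpha> i"
    by auto
  then show ?thesis
    using assms block_eq[OF assms, of i a] by (simp add: labeling_def)
next
  case False
  then have "block N \<alpha> a = {a}"
    by (intro block_singleton) auto
  moreover have "1 \<le> N" "\<forall>i\<in>{1..N}. 2 \<le> card (\<alpha> i)"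
    using assms by (simp_all add: labeling_def)
  then have "2 \<le> card (\<alpha> 1)"
    by simp
  ultimately show ?thesis
    by simp
qed

text \<open>The entry (i, j) of \<open>L i j\<close> is 1, so some summand of the direct sum is
  nonzero there, and its support puts i and j into one \<alpha> b.\<close>

lemma labeling_generator:
  assumes "labeling A N \<alpha>" "L i j \<in> A" "i \<noteq> j"
  shows "j \<in> block N \<alpha> i"
proof -
  have "L i j \<in> lie_generated A"
    using assms hull_subset[of A lie_subalgebra] by (auto simp: lie_generated_def)
  moreover have "lie_generated A = {\<Sum>b=1..N. X b | X. \<forall>b\<in>{1..N}. X b \<in> so_index (\<alpha> b)}"
    using assms(1) by (simp only: labeling_def is_direct_sum_def)
  ultimately obtain X where X: "\<And>b. b \<in> {1..N} \<Longrightarrow> X b \<in> so_index (\<alpha> b)" "L i j = (\<Sum>b=1..N. X b)"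
    by blast
  have "(\<Sum>b=1..N. X b $ i $ j) = L i j $ i $ j"
    by (simp add: X(2))
  also have "\<dots> = 1"
    using assms by (simp add: L_def)
  finally have "(\<Sum>b=1..N. X b $ i $ j) \<noteq> 0"
    by simp
  then obtain b where "b \<in> {1..N}" "X b $ i $ j \<noteq> 0"
    by (meson sum.neutral)
  then show ?thesis
    using so_index_support[OF X(1), of b i j] by (auto simp: block_def)
qed

lemma block_sym: "j \<in> block N \<alpha> i \<longleftrightarrow> i \<in> block N \<alpha> j"
  unfolding block_def mem_Collect_eq by blast

lemma finite_Ls: "finite (Ls :: (real ^ 'n::{finite,linorder} ^ 'n::{finite,linorder}) set)"
proof -
  have "Ls \<subseteq> (\<lambda>z. L (fst z) (snd z)) ` (UNIV :: ('n \<times> 'n) set)"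
  proof
    fix X :: "real ^ 'n::{finite,linorder} ^ 'n::{finite,linorder}" assume "X \<in> Ls"
    then obtain i j where "X = L i j"
      unfolding Ls_def by blast
    then show "X \<in> (\<lambda>z. L (fst z) (snd z)) ` (UNIV :: ('n \<times> 'n) set)"
      by (intro image_eqI[of _ _ "(i, j)"]) simp_all
  qed
  then show ?thesis
    by (rule finite_subset) simp
qed

lemma p_tilde_ge:
  assumes "X \<in> Ls - A J"
  shows "card {k \<in> {1..m}. X \<in> Ls - A k} \<le> p_tilde m A J"
  unfolding p_tilde_def using assms finite_Ls by (intro Max_ge) auto

lemma p_tilde_pos:
  assumes "J \<in> {1..m}" "X \<in> Ls - A J"
  shows "0 < p_tilde m A J"
proof -
  have "0 < card {k \<in> {1..m}. X \<in> Ls - A k}"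
    using assms by (auto simp: card_gt_0_iff)
  then show ?thesis
    using p_tilde_ge[of X A J m] assms by simp
qed

text \<open>For every J in the sum the generator of the pair {a, i} lies outside A^J. All these J
  are counted together in each p_J, so p_J is at least the number of terms.\<close>

lemma sum_inverse_p_tilde_le:
  assumes labeling: "\<And>J. J \<in> {1..m} \<Longrightarrow> labeling (A J) (N J) (\<alpha> J)" and "i \<noteq> a"
  shows "(\<Sum>J | J \<in> {1..m} \<and> i \<notin> block (N J) (\<alpha> J) a. inverse (real (p_tilde m A J))) \<le> 1"
proof -
  define S where "S = {J. J \<in> {1..m} \<and> i \<notin> block (N J) (\<alpha> J) a}"
  \<comment> \<open>\<open>Ls\<close> contains \<open>L i j\<close> for i < j only, so the pair has
    to be ordered.\<close>
  define X where "X = (if i < a then L i a else L a i)"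
  have "X \<in> Ls"
    using assms(2) unfolding X_def Ls_def by (cases i a rule: linorder_cases) (auto dest: less_not_sym)
  moreover have "X \<notin> A J" if "J \<in> S" for J
    using labeling_generator[OF labeling, of J i a] labeling_generator[OF labeling, of J a i] that assms(2)
    by (auto simp: X_def S_def block_sym[of i] split: if_splits)
  ultimately have "S \<subseteq> {J \<in> {1..m}. X \<in> Ls - A J}"
    by (auto simp: S_def)
  then have card: "card S \<le> p_tilde m A J" if "J \<in> S" for J
    using p_tilde_ge[of X A J m] that card_mono[of "{J \<in> {1..m}. X \<in> Ls - A J}" S] by auto
  have "(\<Sum>J\<in>S. inverse (real (p_tilde m A J))) \<le> (\<Sum>J\<in>S. inverse (real (card S)))"
  proof (intro sum_mono le_imp_inverse_le)
    fix J assume "J \<in> S"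
    then show "real (card S) \<le> real (p_tilde m A J)" "0 < real (card S)"
      using card by (auto simp: card_gt_0_iff S_def)
  qed
  also have "\<dots> \<le> 1"
    by (cases "card S = 0") auto
  finally show ?thesis
    unfolding S_def .
qed

text \<open>For an arbitrary coordinate \<open>a\<close>, n - |alpha_1^J| is at most the number of i
  outside the block of \<open>a\<close>. Exchanging the sums over J and i, each of the n - 1
  coordinates i different from \<open>a\<close> contributes at most 1.\<close>

lemma delta_tilde_ge_1:
  assumes labeling: "\<And>J. J \<in> {1..m} \<Longrightarrow> labeling (A J) (N J) (\<alpha> J)"
  shows "1 \<le> delta_tilde m (A :: nat \<Rightarrow> (real ^ 'n::{finite,linorder} ^ 'n::{finite,linorder}) set) \<alpha>"
proof -
  fix a :: 'n
  define q where "q J = inverse (real (p_tilde m A J))" for J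
  have "(\<Sum>J=1..m. q J * (real CARD('n) - real (card (\<alpha> J 1))))
      \<le> (\<Sum>J=1..m. q J * real (card (- block (N J) (\<alpha> J) a)))"
  proof (intro sum_mono mult_left_mono)
    fix J assume "J \<in> {1..m}"
    have "card (- block (N J) (\<alpha> J) a) = CARD('n) - card (block (N J) (\<alpha> J) a)"
      by (metis Compl_eq_Diff_UNIV card_Diff_subset finite subset_UNIV)
    then show "real CARD('n) - real (card (\<alpha> J 1)) \<le> real (card (- block (N J) (\<alpha> J) a))"
      using card_block_le[OF labeling[OF \<open>J \<in> {1..m}\<close>], of a] by linarith
  qed (simp add: q_def)
  also have "\<dots> = (\<Sum>J=1..m. \<Sum>i\<in>-{a}. if i \<notin> block (N J) (\<alpha> J) a then q J else 0)"
  proof (intro sum.cong refl)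
    fix J
    have "(\<Sum>i\<in>-{a}. if i \<notin> block (N J) (\<alpha> J) a then q J else 0) = (\<Sum>i\<in>- block (N J) (\<alpha> J) a. q J)"
      by (rule sum.mono_neutral_cong_right) (auto simp: block_def)
    then show "q J * real (card (- block (N J) (\<alpha> J) a)) = (\<Sum>i\<in>-{a}. if i \<notin> block (N J) (\<alpha> J) a then q J else 0)"
      by simp
  qed
  also have "\<dots> = (\<Sum>i\<in>-{a}. \<Sum>J=1..m. if i \<notin> block (N J) (\<alpha> J) a then q J else 0)"
    by (rule sum.swap)
  also have "\<dots> \<le> (\<Sum>i\<in>-{a}. 1)"
  proof (rule sum_mono)
    fix i assume "i \<in> - {a}"
    then have "(\<Sum>J | J \<in> {1..m} \<and> i \<notin> block (N J) (\<alpha> J) a. q J) \<le> 1"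
      unfolding q_def using labeling by (intro sum_inverse_p_tilde_le) auto
    moreover have "(\<Sum>J | J \<in> {1..m} \<and> i \<notin> block (N J) (\<alpha> J) a. q J)
        = (\<Sum>J=1..m. if i \<notin> block (N J) (\<alpha> J) a then q J else 0)"
      by (rule sum.mono_neutral_cong_left) auto
    ultimately show "(\<Sum>J=1..m. if i \<notin> block (N J) (\<alpha> J) a then q J else 0) \<le> 1"
      by simp
  qed
  also have "\<dots> = real CARD('n) - 1"
  proof -
    have "card (- {a}) = CARD('n) - 1"
      by (metis Compl_eq_Diff_UNIV UNIV_I card_Diff_singleton)
    then show ?thesis
      by (simp add: of_nat_diff Suc_leI)
  qed
  finally show ?thesis
    by (simp add: delta_tilde_def q_def)
qed

section \<open>Plane rotations and their use on symmetric functions\<close>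

definition givens :: "'n \<Rightarrow> 'n \<Rightarrow> real \<Rightarrow> real \<Rightarrow> real ^ 'n ^ 'n" where
  "givens i j c s = (\<chi> k l. if k = i then (if l = i then c else if l = j then - s else 0)
     else if k = j then (if l = i then s else if l = j then c else 0) else if k = l then 1 else 0)"

lemma givens_mult:
  fixes i j :: "'n::finite"
  assumes "i \<noteq> j"
  shows "givens i j c s *v x = (\<chi> k. if k = i then c * x $ i - s * x $ j
    else if k = j then s * x $ i + c * x $ j else x $ k)"
proof -
  have "(\<Sum>l\<in>UNIV. (givens i j c s) $ k $ l * x $ l) = (if k = i then c * x $ i - s * x $ j
    else if k = j then s * x $ i + c * x $ j else x $ k)" for k
  proof -
    have "(\<Sum>l\<in>UNIV. (givens i j c s) $ k $ l * x $ l) = (if k = i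
        then (\<Sum>l\<in>UNIV. (if l = i then c * x $ i else 0) - (if l = j then s * x $ j else 0))
        else if k = j then (\<Sum>l\<in>UNIV. (if l = i then s * x $ i else 0) + (if l = j then c * x $ j else 0))
        else (\<Sum>l\<in>UNIV. if l = k then x $ k else 0))"
    proof -
      have "(\<Sum>l\<in>UNIV. (if k = l then 1 else 0) * x $ l) = (\<Sum>l\<in>UNIV. if l = k then x $ k else 0)"
        by (intro sum.cong) auto
      then show ?thesis
        using assms by (auto simp: givens_def intro!: sum.cong)
    qed
    then show ?thesis
      by (simp add: sum_subtractf sum.distrib)
  qed
  then show ?thesis
    by (simp add: matrix_vector_mult_def)
qed

lemma orthogonal_matrix_givens:
  fixes i j :: "'n::finite"
  assumes "i \<noteq> j" "c\<^sup>2 + s\<^sup>2 = 1"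
  shows "orthogonal_matrix (givens i j c s)"
proof -
  have "norm (givens i j c s *v x) = norm x" for x :: "real ^ 'n"
  proof -
    define y where "y = givens i j c s *v x"
    have split: "(\<Sum>k\<in>UNIV. w k) = w i + (w j + (\<Sum>k\<in>-{i, j}. w k))" for w :: "'n \<Rightarrow> real"
    proof -
      have "(\<Sum>k\<in>UNIV. w k) = (\<Sum>k\<in>insert i (insert j (- {i, j})). w k)"
        by (rule sum.cong) auto
      then show ?thesis
        using assms by simp
    qed
    have "(\<Sum>k\<in>UNIV. (y $ k)\<^sup>2) = (y $ i)\<^sup>2 + ((y $ j)\<^sup>2 + (\<Sum>k\<in>-{i, j}. (y $ k)\<^sup>2))"
      by (rule split)
    also have "(\<Sum>k\<in>-{i, j}. (y $ k)\<^sup>2) = (\<Sum>k\<in>-{i, j}. (x $ k)\<^sup>2)"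
      using assms by (intro sum.cong) (auto simp: y_def givens_mult)
    also have "(y $ i)\<^sup>2 + ((y $ j)\<^sup>2 + (\<Sum>k\<in>-{i, j}. (x $ k)\<^sup>2))
      = (c\<^sup>2 + s\<^sup>2) * (x $ i)\<^sup>2 + ((c\<^sup>2 + s\<^sup>2) * (x $ j)\<^sup>2 + (\<Sum>k\<in>-{i, j}. (x $ k)\<^sup>2))"
      using assms(1) by (simp add: y_def givens_mult power2_eq_square algebra_simps)
    also have "\<dots> = (\<Sum>k\<in>UNIV. (x $ k)\<^sup>2)"
      using assms(2) by (simp add: split)
    finally show ?thesis
      by (simp add: y_def norm_vec_def L2_set_def)
  qed
  then have "orthogonal_transformation ((*v) (givens i j c s))"
    by (simp add: orthogonal_transformation)
  then show ?thesis
    by (simp add: orthogonal_transformation_matrix)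
qed

text \<open>The matrix is the square of the rotation by half the angle, which is orthogonal; its
  determinant is therefore the square of 1 or -1.\<close>

lemma rotation_matrix_givens:
  fixes i j :: "'n::finite"
  assumes "i \<noteq> j" "c\<^sup>2 + s\<^sup>2 = 1"
  shows "rotation_matrix (givens i j c s)"
proof -
  obtain t where t: "c = cos t" "s = sin t"
    using sincos_total_2pi[OF assms(2)] by metis
  define P where "P = givens i j (cos (t / 2)) (sin (t / 2))"
  have double: "c = cos (t / 2) * cos (t / 2) - sin (t / 2) * sin (t / 2)"
    "s = sin (t / 2) * cos (t / 2) + cos (t / 2) * sin (t / 2)"
    using cos_add[of "t / 2" "t / 2"] sin_add[of "t / 2" "t / 2"] by (simp_all add: t)
  have "givens i j c s *v x = (P ** P) *v x" for x
    using assms(1) unfolding matrix_vector_mul_assoc[symmetric] P_def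
    by (simp add: givens_mult vec_eq_iff double algebra_simps)
  then have "givens i j c s = P ** P"
    by (simp add: matrix_eq)
  moreover have "det P = 1 \<or> det P = - 1"
    unfolding P_def using assms(1) by (intro det_orthogonal_matrix orthogonal_matrix_givens) auto
  ultimately have "det (givens i j c s) = 1"
    by (auto simp: det_mul)
  then show ?thesis
    using assms by (simp add: rotation_matrix_def orthogonal_matrix_givens)
qed

text \<open>On the other index sets the identity serves as the required element of
  \<open>SO_index\<close>, since a rotation in two coordinates of \<alpha> b moves nothing
  there.\<close>

lemma symmetric_fun_givens:
  assumes "symmetric_fun N \<alpha> F" and ij: "i \<noteq> j" and cs: "c\<^sup>2 + s\<^sup>2 = 1"
    and b: "b \<in> {1..N}" "i \<in> \<alpha> b" "j \<in> \<alpha> b" and disj: "\<And>b'. b' \<in> {1..N} \<Longrightarrow> b' \<noteq> b \<Longrightarrow> \<alpha> b' \<inter> \<alpha> b = {}"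
  shows "F (givens i j c s *v x) = F x"
proof -
  have "admissible_rotation N \<alpha> ((*v) (givens i j c s))"
    unfolding admissible_rotation_def
  proof (intro conjI ballI allI impI)
    fix b' assume b': "b' \<in> {1..N}"
    show "\<exists>Q\<in>SO_index (\<alpha> b'). \<forall>x. \<forall>k\<in>\<alpha> b'. (givens i j c s *v x) $ k = (Q *v x) $ k"
    proof (cases "b' = b")
      case True
      have "givens i j c s \<in> SO_index (\<alpha> b)"
        using ij cs b by (auto simp: SO_index_def rotation_matrix_givens givens_mult vec_eq_iff axis_def)
      then show ?thesis
        using True by blast
    next
      case False
      have "mat 1 \<in> SO_index (\<alpha> b')"
        by (simp add: SO_index_def rotation_matrix_def orthogonal_matrix_id)
      moreover have "(givens i j c s *v x) $ k = (mat 1 *v x) $ k" if "k \<in> \<alpha> b'" for x k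
        using disj[OF b' False] that b ij by (auto simp: givens_mult)
      ultimately show ?thesis
        by blast
    qed
  next
    fix x k assume "k \<notin> (\<Union>b\<in>{1..N}. \<alpha> b)"
    then show "(givens i j c s *v x) $ k = x $ k"
      using b ij by (auto simp: givens_mult)
  qed
  then show ?thesis
    using assms(1) by (simp add: symmetric_fun_def)
qed

text \<open>The coordinates in \<open>D\<close> are rotated into the coordinate \<open>a\<close> one after the other.\<close>

lemma symmetric_fun_collapse:
  fixes F :: "real ^ 'n::{finite,linorder} \<Rightarrow> real"
  assumes lab: "labeling A N \<alpha>" and sym: "symmetric_fun N \<alpha> F" and e: "\<bar>e\<bar> = 1"
    and "finite D" "D \<subseteq> block N \<alpha> a - {a}" "0 \<le> e * x $ a"
  shows "F x = F (\<chi> k. if k = a then e * sqrt ((x $ a)\<^sup>2 + (\<Sum>i\<in>D. (x $ i)\<^sup>2)) else if k \<in> D then 0 else x $ k)"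
  using assms(4-)
proof (induction D arbitrary: x rule: finite_induct)
  case empty
  have "e * sqrt ((x $ a)\<^sup>2) = x $ a"
    using e empty by (auto simp: abs_if split: if_splits)
  then have "(\<chi> k. if k = a then e * sqrt ((x $ a)\<^sup>2 + (\<Sum>i\<in>{}. (x $ i)\<^sup>2)) else if k \<in> {} then 0 else x $ k) = x"
    by (simp add: vec_eq_iff)
  then show ?case
    by simp
next
  case (insert j D)
  define r where "r = sqrt ((x $ a)\<^sup>2 + (x $ j)\<^sup>2)"
  obtain b where b: "b \<in> {1..N}" "a \<in> \<alpha> b" "j \<in> \<alpha> b"
    using insert.prems by (auto simp: block_def)
  have disj: "\<alpha> b' \<inter> \<alpha> b = {}" if "b' \<in> {1..N}" "b' \<noteq> b" for b'
    using lab b that by (auto simp: labeling_def disjnt_def)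
  have aj: "a \<noteq> j" "a \<notin> D" "j \<notin> D"
    using insert by auto
  have e2: "e * e = 1"
    using e by (auto simp: abs_if split: if_splits)
  \<comment> \<open>Cosine and sine of the rotation taking (x_a, x_j) to (e r, 0). For r = 0 both
    coordinates already vanish and the identity is taken.\<close>
  define c where "c = (if r = 0 then 1 else e * x $ a / r)"
  define s where "s = (if r = 0 then 0 else - e * x $ j / r)"
  have r2: "r\<^sup>2 = (x $ a)\<^sup>2 + (x $ j)\<^sup>2"
    by (simp add: r_def)
  have "c\<^sup>2 + s\<^sup>2 = 1"
  proof (cases "r = 0")
    case False
    have "c\<^sup>2 + s\<^sup>2 = ((e * e) * (x $ a)\<^sup>2 + (e * e) * (x $ j)\<^sup>2) / r\<^sup>2"
      using False by (simp add: c_def s_def power2_eq_square add_divide_distrib mult_ac)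
    then show ?thesis
      using False by (simp add: e2 r2[symmetric])
  qed (simp add: c_def s_def)
  then have rotate: "F (givens a j c s *v x) = F x"
    using b disj aj by (intro symmetric_fun_givens[OF sym]) auto
  define y where "y = givens a j c s *v x"
  have "c * x $ a - s * x $ j = e * r" "s * x $ a + c * x $ j = 0"
  proof -
    have "r = 0 \<Longrightarrow> x $ a = 0 \<and> x $ j = 0"
      using r2 by (simp add: sum_power2_eq_zero_iff)
    moreover have "e * x $ a / r * x $ a - (- e * x $ j / r) * x $ j = e * r" if "r \<noteq> 0"
    proof -
      have "e * x $ a / r * x $ a - (- e * x $ j / r) * x $ j = e * ((x $ a)\<^sup>2 + (x $ j)\<^sup>2) / r"
        by (simp add: power2_eq_square add_divide_distrib algebra_simps)
      also have "\<dots> = e * r"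
        unfolding r2[symmetric] using that by (simp add: power2_eq_square)
      finally show ?thesis .
    qed
    ultimately show "c * x $ a - s * x $ j = e * r" "s * x $ a + c * x $ j = 0"
      by (auto simp: c_def s_def)
  qed
  then have y: "y = (\<chi> k. if k = a then e * r else if k = j then 0 else x $ k)"
    using aj(1) by (simp add: y_def givens_mult cong: if_cong)
  have "F y = F (\<chi> k. if k = a then e * sqrt ((y $ a)\<^sup>2 + (\<Sum>i\<in>D. (y $ i)\<^sup>2)) else if k \<in> D then 0 else y $ k)"
  proof (rule insert.IH)
    have "e * y $ a = (e * e) * r"
      by (simp add: y)
    then show "0 \<le> e * y $ a"
      by (simp add: e2 r_def)
  qed (use insert.prems in auto)
  also have "(\<chi> k. if k = a then e * sqrt ((y $ a)\<^sup>2 + (\<Sum>i\<in>D. (y $ i)\<^sup>2)) else if k \<in> D then 0 else y $ k)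
    = (\<chi> k. if k = a then e * sqrt ((x $ a)\<^sup>2 + (\<Sum>i\<in>insert j D. (x $ i)\<^sup>2)) else if k \<in> insert j D then 0 else x $ k)"
  proof -
    have "(\<Sum>i\<in>D. (y $ i)\<^sup>2) = (\<Sum>i\<in>D. (x $ i)\<^sup>2)"
      using aj by (intro sum.cong) (auto simp: y)
    moreover have "(y $ a)\<^sup>2 = (e * e) * r\<^sup>2"
      by (simp add: y power2_eq_square)
    ultimately have "(y $ a)\<^sup>2 + (\<Sum>i\<in>D. (y $ i)\<^sup>2) = (x $ a)\<^sup>2 + (\<Sum>i\<in>insert j D. (x $ i)\<^sup>2)"
      using insert.hyps by (simp add: e2 r2)
    then show ?thesis
      using aj by (simp add: vec_eq_iff) (auto simp: y)
  qed
  finally show ?case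
    using rotate by (simp add: y_def)
qed

text \<open>Both points collapse to the same normal form \<open>z\<close>: outside the block they
  agree, inside it everything is 0 except at \<open>a\<close>, and there the value is determined by
  the square sum and the sign e.\<close>

lemma symmetric_fun_invariant:
  fixes f :: "('n::{finite,linorder} \<Rightarrow> real) \<Rightarrow> real" and x y :: "'n \<Rightarrow> real"
  assumes lab: "labeling A N \<alpha>" and sym: "symmetric_fun N \<alpha> (\<lambda>x. f (coords W x))" and e: "\<bar>e\<bar> = 1"
    and outside: "\<And>i. i \<notin> block N \<alpha> a \<Longrightarrow> x i = y i"
    and sum: "(\<Sum>i\<in>block N \<alpha> a. (x i)\<^sup>2) = (\<Sum>i\<in>block N \<alpha> a. (y i)\<^sup>2)"
    and sign: "0 \<le> e * x a" "0 \<le> e * y a"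
  shows "f (restrict x W) = f (restrict y W)"
proof -
  define D where "D = block N \<alpha> a - {a}"
  define z :: "('n \<Rightarrow> real) \<Rightarrow> real ^ 'n::{finite,linorder}" where
    "z w = (\<chi> k. if k = a then e * sqrt ((w a)\<^sup>2 + (\<Sum>i\<in>D. (w i)\<^sup>2)) else if k \<in> D then 0 else w k)" for w
  have collapse: "f (restrict w W) = f (coords W (z w))" if "0 \<le> e * w a" for w
    using symmetric_fun_collapse[OF lab sym e, of D a "\<chi> i. w i"] that
    by (simp add: D_def z_def coords_def cong: if_cong)
  have "a \<in> block N \<alpha> a"
    by (simp add: block_def)
  then have "(\<Sum>i\<in>block N \<alpha> a. (w i)\<^sup>2) = (w a)\<^sup>2 + (\<Sum>i\<in>D. (w i)\<^sup>2)" for w :: "'n \<Rightarrow> real"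
    unfolding D_def by (intro sum.remove) auto
  then have "z x = z y"
    using sum outside by (auto simp: z_def vec_eq_iff D_def)
  then show ?thesis
    using collapse sign by metis
qed

section \<open>The integral over one region\<close>

lemma measurable_vec_lambda_Lb:
  "(\<lambda>x. \<chi> i. x i :: real ^ 'n::finite) \<in> Lb UNIV \<rightarrow>\<^sub>M borel"
proof (subst borel_measurable_euclidean_space, rule ballI)
  fix b :: "real ^ 'n" assume "b \<in> Basis"
  then obtain i where b: "b = axis i 1"
    by (auto simp: Basis_vec_def)
  have "(\<lambda>x. x i) \<in> Lb UNIV \<rightarrow>\<^sub>M lborel"
    by (rule measurable_component_singleton) simp
  then show "(\<lambda>x. (\<chi> i. x i) \<bullet> b) \<in> borel_measurable (Lb UNIV)"
    by (simp add: b inner_axis)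
qed

lemma lborel_eq_distr_Lb:
  "(lborel :: (real ^ 'n::finite) measure) = distr (Lb UNIV) borel (\<lambda>x. \<chi> i. x i)"
proof (rule lborel_eqI)
  fix l u :: "real ^ 'n" assume le: "\<And>b. b \<in> Basis \<Longrightarrow> l \<bullet> b \<le> u \<bullet> b"
  have le': "l $ i \<le> u $ i" for i
    using le[of "axis i 1"] by (simp add: inner_axis)
  have "(\<lambda>x. \<chi> i. x i) -` box l u \<inter> space (Lb UNIV) = Pi\<^sub>E UNIV (\<lambda>i. {l $ i<..<u $ i})"
    by (auto simp: mem_box_cart space_PiM PiE_def Pi_iff)
  then have "emeasure (distr (Lb UNIV) borel (\<lambda>x. \<chi> i. x i)) (box l u)
      = emeasure (Lb UNIV) (Pi\<^sub>E UNIV (\<lambda>i. {l $ i<..<u $ i}))"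
    by (subst emeasure_distr[OF measurable_vec_lambda_Lb]) auto
  also have "\<dots> = (\<Prod>i\<in>UNIV. ennreal (u $ i - l $ i))"
    by (subst lborel_prod.emeasure_PiM) (auto simp: le')
  also have "\<dots> = ennreal (\<Prod>i\<in>UNIV. u $ i - l $ i)"
    using le' by (intro prod_ennreal) auto
  also have "(\<Prod>i\<in>UNIV. u $ i - l $ i) = (\<Prod>b\<in>Basis. (u - l) \<bullet> b)"
  proof -
    have "(Basis :: (real ^ 'n) set) = (\<lambda>i. axis i 1) ` UNIV"
      by (auto simp: Basis_vec_def)
    then have "(\<Prod>b\<in>Basis. (u - l) \<bullet> b) = (\<Prod>b\<in>(\<lambda>i. axis i 1) ` UNIV. (u - l) \<bullet> b)"
      by (rule arg_cong)
    also have "\<dots> = (\<Prod>i\<in>UNIV. (u - l) \<bullet> axis i 1)"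
      by (subst prod.reindex) (auto simp: inj_on_def axis_eq_axis)
    finally show ?thesis
      by (simp add: inner_axis)
  qed
  finally show "emeasure (distr (Lb UNIV) borel (\<lambda>x. \<chi> i. x i)) (box l u) = ennreal (\<Prod>b\<in>Basis. (u - l) \<bullet> b)" .
qed simp

lemma measurable_vec_nth_Lb: "(\<lambda>x i. x $ i) \<in> borel \<rightarrow>\<^sub>M Lb (UNIV :: 'n::finite set)"
proof (rule measurable_PiM_single')
  fix i :: 'n
  have "(\<lambda>x. x $ i) = (\<lambda>x :: real ^ 'n. x \<bullet> axis i 1)"
    by (simp add: inner_axis)
  then show "(\<lambda>x :: real ^ 'n. x $ i) \<in> borel \<rightarrow>\<^sub>M lborel"
    by simp
qed simp

lemma nn_integral_lborel_vec:
  fixes G :: "('n::finite \<Rightarrow> real) \<Rightarrow> ennreal"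
  assumes G: "G \<in> borel_measurable (Lb UNIV)"
  shows "(\<integral>\<^sup>+x. G (\<lambda>i. x $ i) \<partial>(lborel :: (real ^ 'n) measure)) = (\<integral>\<^sup>+y. G y \<partial>Lb UNIV)"
proof -
  have id: "($) (vec_lambda y) = y" for y :: "'n \<Rightarrow> real"
    by (rule ext) simp
  have "(\<lambda>x :: real ^ 'n. G (\<lambda>i. x $ i)) \<in> borel_measurable borel"
    by (rule measurable_compose[OF measurable_vec_nth_Lb G])
  then show ?thesis
    unfolding lborel_eq_distr_Lb by (subst nn_integral_distr[OF measurable_vec_lambda_Lb]) (auto simp: id)
qed

lemma nn_integral_powr_from_0:
  assumes "0 < \<beta>" "0 \<le> c"
  shows "(\<integral>\<^sup>+s. ennreal (s powr (\<beta> - 1)) * indicator {0..c} s \<partial>lborel) = ennreal (c powr \<beta> / \<beta>)"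
proof -
  have "((\<lambda>s. if s \<in> {0..c} then s powr (\<beta> - 1) else 0) has_integral (c powr \<beta> / \<beta>)) UNIV"
    using has_integral_powr_from_0[of "\<beta> - 1" c] assms by (simp only: has_integral_restrict_UNIV) simp
  then have "(\<integral>\<^sup>+s. ennreal (if s \<in> {0..c} then s powr (\<beta> - 1) else 0) \<partial>lborel) = ennreal (c powr \<beta> / \<beta>)"
    by (intro nn_integral_has_integral_lborel) auto
  moreover have "(\<integral>\<^sup>+s. ennreal (if s \<in> {0..c} then s powr (\<beta> - 1) else 0) \<partial>lborel)
      = (\<integral>\<^sup>+s. ennreal (s powr (\<beta> - 1)) * indicator {0..c} s \<partial>lborel)"
    by (intro nn_integral_cong) (auto simp: indicator_def)
  ultimately show ?thesis
    by simp
qed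

section \<open>All factors together in one region\<close>

locale region_family =
  fixes S :: "'j set" and f :: "'j \<Rightarrow> ('n::finite \<Rightarrow> real) \<Rightarrow> real" and V B :: "'j \<Rightarrow> 'n set"
    and a :: 'n and e :: real and p :: "'j \<Rightarrow> real" and g :: "'j \<Rightarrow> ('n \<Rightarrow> real) \<Rightarrow> ennreal" and \<delta> :: real
  assumes S: "finite S"
    and region: "\<And>j. j \<in> S \<Longrightarrow> region_function (f j) (V j) (B j) a e (p j) (g j)"
    and p: "\<And>j. j \<in> S \<Longrightarrow> 0 < p j"
    and weights: "\<And>i. i \<noteq> a \<Longrightarrow> (\<Sum>j | j \<in> S \<and> i \<notin> B j. inverse (p j)) \<le> 1"
    and e: "\<bar>e\<bar> = 1"
    and \<delta>: "\<delta> = real CARD('n) - (\<Sum>j\<in>S. inverse (p j) * (real CARD('n) - real (card (V j))))" "0 < \<delta>"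
begin

abbreviation hh :: "'j \<Rightarrow> ('n \<Rightarrow> real) \<Rightarrow> ennreal" where
  "hh j \<equiv> region_function.h (V j) (B j) a e (g j)"

abbreviation q :: "'j \<Rightarrow> real" where
  "q j \<equiv> inverse (p j)"

text \<open>sqrt n / 2 comes from replacing x_a by \<sigma>, 2^(n - 1) from the volume of the cube,
  and pi n^n, raised to the total weight, from \<open>nn_integral_h\<close>.\<close>

definition C0 :: real where
  "C0 = sqrt (real CARD('n)) / 2 * 2 ^ (CARD('n) - 1) * (pi * real CARD('n) ^ CARD('n)) powr (\<Sum>j\<in>S. q j)"

lemma C0_pos: "0 < C0"
  by (simp add: C0_def)

lemma measurable_hh_upd: "j \<in> S \<Longrightarrow> (\<lambda>x. hh j (x(a := t))) \<in> borel_measurable (Lb (-{a}))"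
  using measurable_compose[OF measurable_upd_const_Lb[of UNIV a "-{a}" t] region_function.measurable_h[OF region]] by auto

text \<open>Finner's inequality in the coordinates other than \<open>a\<close>, the j-th factor
  depending on those outside \<open>B j\<close> only. The exponent of r is n - 1 from the cube plus
  the sum of q_j (|V_j| - n), which is \<delta> - n, from the factors.\<close>

lemma nn_integral_slice:
  assumes r: "0 < r"
  shows "(\<integral>\<^sup>+x. (\<Prod>j\<in>S. epowr (q j) (hh j (x(a := r\<^sup>2)))) * indicator {x. \<forall>i\<in>-{a}. \<bar>x i\<bar> \<le> r} x \<partial>Lb (-{a}))
    \<le> ennreal (2 ^ (CARD('n) - 1) * (pi * real CARD('n) ^ CARD('n)) powr (\<Sum>j\<in>S. q j) * r powr (\<delta> - 1))
      * (\<Prod>j\<in>S. epowr (q j) (\<integral>\<^sup>+x. g j x \<partial>Lb (- V j)))" (is "?I \<le> _ * ?G")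
proof -
  define n where "n = CARD('n)"
  define K where "K = pi * real n ^ n"
  have K: "0 < K"
    by (simp add: K_def n_def)
  have n: "card (- {a}) = n - 1" "1 \<le> n"
    by (metis Compl_eq_Diff_UNIV UNIV_I card_Diff_singleton n_def) (simp add: n_def Suc_leI)
  have "(\<integral>\<^sup>+x. (\<Prod>j\<in>S. epowr (q j) (hh j (x(a := r\<^sup>2)))) \<partial>Pi\<^sub>M (-{a}) (\<lambda>_. U r)) = ennreal ((1 / (2 * r)) ^ (n - 1)) * ?I"
    using r measurable_hh_upd n(1) by (subst nn_integral_PiM_U) (auto intro!: borel_measurable_prod_ennreal measurable_epowr)
  then have "ennreal ((2 * r) ^ (n - 1)) * (\<integral>\<^sup>+x. (\<Prod>j\<in>S. epowr (q j) (hh j (x(a := r\<^sup>2)))) \<partial>Pi\<^sub>M (-{a}) (\<lambda>_. U r))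
      = ennreal ((2 * r) ^ (n - 1)) * ennreal ((1 / (2 * r)) ^ (n - 1)) * ?I"
    by (simp only: mult.assoc)
  also have "ennreal ((2 * r) ^ (n - 1)) * ennreal ((1 / (2 * r)) ^ (n - 1)) = ennreal ((2 * r) ^ (n - 1) * (1 / (2 * r)) ^ (n - 1))"
    using r by (intro ennreal_mult[symmetric]) auto
  also have "(2 * r) ^ (n - 1) * (1 / (2 * r)) ^ (n - 1) = 1"
    using r by (simp only: power_mult_distrib[symmetric]) simp
  finally have "?I = ennreal ((2 * r) ^ (n - 1)) * (\<integral>\<^sup>+x. (\<Prod>j\<in>S. epowr (q j) (hh j (x(a := r\<^sup>2)))) \<partial>Pi\<^sub>M (-{a}) (\<lambda>_. U r))"
    by (simp only: ennreal_1 mult_1_left)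
  also have "(\<integral>\<^sup>+x. (\<Prod>j\<in>S. epowr (q j) (hh j (x(a := r\<^sup>2)))) \<partial>Pi\<^sub>M (-{a}) (\<lambda>_. U r))
      \<le> (\<Prod>j\<in>S. epowr (q j) (\<integral>\<^sup>+x. hh j (x(a := r\<^sup>2)) \<partial>Pi\<^sub>M (-{a}) (\<lambda>_. U r)))"
  proof (rule finner_inequality[where D = "\<lambda>j. - B j"])
    show "prob_space (U r)"
      using r by (rule prob_space_U)
    show "(\<lambda>x. hh j (x(a := r\<^sup>2))) \<in> borel_measurable (Pi\<^sub>M (-{a}) (\<lambda>_. U r))" if "j \<in> S" for j
      using measurable_hh_upd[OF that] by (simp add: measurable_cong_sets[OF sets_PiM_U refl])
    show "hh j ((x(i := t))(a := r\<^sup>2)) = hh j (x(a := r\<^sup>2))" if "j \<in> S" "i \<in> - {a}" "i \<notin> - B j" for j i x t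
    proof -
      have "i \<in> region_function.T (B j) a"
        using that by (simp add: region_function.T_def[OF region[OF that(1)]])
      moreover have "(x(i := t))(a := r\<^sup>2) = (x(a := r\<^sup>2))(i := t)"
        using that by (auto simp: fun_eq_iff)
      ultimately show ?thesis
        using region_function.h_independent[OF region[OF that(1)]] by simp
    qed
    show "(\<Sum>j | j \<in> S \<and> i \<in> - B j. q j) \<le> 1" if "i \<in> - {a}" for i
      using weights[of i] that by simp
  qed (use S p in auto)
  also have "\<dots> \<le> (\<Prod>j\<in>S. ennreal ((K * r powr (real (card (V j)) - real n)) powr q j) * epowr (q j) (\<integral>\<^sup>+x. g j x \<partial>Lb (- V j)))"
  proof (intro prod_mono_ennreal)
    fix j assume j: "j \<in> S"
    have "epowr (q j) (\<integral>\<^sup>+x. hh j (x(a := r\<^sup>2)) \<partial>Pi\<^sub>M (-{a}) (\<lambda>_. U r))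
      \<le> epowr (q j) (ennreal (K * r powr (real (card (V j)) - real n)) * (\<integral>\<^sup>+x. g j x \<partial>Lb (- V j)))"
      unfolding K_def n_def using p[OF j] r
      by (intro epowr_mono region_function.nn_integral_h[OF region[OF j]]) auto
    then show "epowr (q j) (\<integral>\<^sup>+x. hh j (x(a := r\<^sup>2)) \<partial>Pi\<^sub>M (-{a}) (\<lambda>_. U r))
      \<le> ennreal ((K * r powr (real (card (V j)) - real n)) powr q j) * epowr (q j) (\<integral>\<^sup>+x. g j x \<partial>Lb (- V j))"
      using K r by (simp add: epowr_cmult)
  qed
  also have "\<dots> = ennreal (\<Prod>j\<in>S. (K * r powr (real (card (V j)) - real n)) powr q j) * ?G"
    by (simp add: prod.distrib prod_ennreal)
  also have "(\<Prod>j\<in>S. (K * r powr (real (card (V j)) - real n)) powr q j)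
      = K powr (\<Sum>j\<in>S. q j) * r powr (\<delta> - real n)"
  proof -
    have "(\<Prod>j\<in>S. (K * r powr (real (card (V j)) - real n)) powr q j)
      = (\<Prod>j\<in>S. K powr q j * r powr (q j * (real (card (V j)) - real n)))"
      using K r by (intro prod.cong) (auto simp: powr_mult powr_powr mult.commute)
    also have "\<dots> = K powr (\<Sum>j\<in>S. q j) * r powr (\<Sum>j\<in>S. q j * (real (card (V j)) - real n))"
      using K r by (simp add: prod.distrib powr_sum)
    also have "(\<Sum>j\<in>S. q j * (real (card (V j)) - real n)) = \<delta> - real n"
      unfolding \<delta> n_def by (simp add: sum_negf[symmetric] algebra_simps)
    finally show ?thesis .
  qed
  finally have "?I \<le> ennreal ((2 * r) ^ (n - 1)) * (ennreal (K powr (\<Sum>j\<in>S. q j) * r powr (\<delta> - real n)) * ?G)"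
    by (simp add: mult_left_mono del: fun_upd_apply)
  also have "\<dots> = ennreal ((2 * r) ^ (n - 1) * (K powr (\<Sum>j\<in>S. q j) * r powr (\<delta> - real n))) * ?G"
    using r by (subst ennreal_mult) (auto simp: mult.assoc)
  also have "(2 * r) ^ (n - 1) * (K powr (\<Sum>j\<in>S. q j) * r powr (\<delta> - real n))
      = 2 ^ (n - 1) * K powr (\<Sum>j\<in>S. q j) * r powr (\<delta> - 1)"
  proof -
    have "r powr (\<delta> - 1) = r powr (real (n - 1) + (\<delta> - real n))"
      using n by (simp add: of_nat_diff)
    also have "\<dots> = r ^ (n - 1) * r powr (\<delta> - real n)"
      using r by (simp only: powr_add powr_realpow)
    finally show ?thesis
      by (simp add: power_mult_distrib)
  qed
  finally show ?thesis
    by (simp only: n_def K_def)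
qed

text \<open>The bound in the new coordinates, with \<open>y a\<close> in the role of \<sigma>. The
  last condition in the indicator reads \<sigma> \<le> n x_a^2; this consequence of |x_a| being the
  largest coordinate is what is retained of the region.\<close>

definition \<Psi> :: "real \<Rightarrow> ('n \<Rightarrow> real) \<Rightarrow> ennreal" where
  "\<Psi> R y = indicator {y. 0 < y a \<and> y a < R\<^sup>2 \<and> y a \<le> real CARD('n) * (y a - (\<Sum>i\<in>-{a}. (y i)\<^sup>2))} y *
    (\<Prod>j\<in>S. epowr (q j) (hh j y))"

lemma measurable_\<Psi> [measurable]: "\<Psi> R \<in> borel_measurable (Lb UNIV)"
proof -
  note [measurable] = measurable_component_Lb
  have "{y \<in> space (Lb UNIV). 0 < y a \<and> y a < R\<^sup>2 \<and> y a \<le> real CARD('n) * (y a - (\<Sum>i\<in>-{a}. (y i)\<^sup>2))} \<in> sets (Lb UNIV)"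
    by (intro sets.sets_Collect_conj borel_measurable_le borel_measurable_less) measurable
  then have "{y. 0 < y a \<and> y a < R\<^sup>2 \<and> y a \<le> real CARD('n) * (y a - (\<Sum>i\<in>-{a}. (y i)\<^sup>2))} \<in> sets (Lb UNIV)"
    by (simp add: space_PiM)
  then show ?thesis
    unfolding \<Psi>_def[abs_def] using region
    by (intro borel_measurable_times_ennreal borel_measurable_indicator borel_measurable_prod_ennreal
      measurable_epowr region_function.measurable_h) auto
qed

definition G :: "real \<Rightarrow> ('n \<Rightarrow> real) \<Rightarrow> ennreal" where
  "G R x = \<Psi> R (x(a := (\<Sum>i\<in>UNIV. (x i)\<^sup>2))) * indicator {0..} (e * x a)"

lemma measurable_G: "G R \<in> borel_measurable (Lb UNIV)"
proof -
  note [measurable] = measurable_component_Lb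
  have "(\<lambda>x. x(a := (\<Sum>i\<in>UNIV. (x i)\<^sup>2))) \<in> Lb UNIV \<rightarrow>\<^sub>M Lb UNIV"
  proof (rule measurable_fun_upd[where J=UNIV])
    have "(\<lambda>x. \<Sum>i\<in>UNIV. (x i)\<^sup>2) \<in> borel_measurable (Lb (UNIV :: 'n set))"
      by measurable
    then show "(\<lambda>x. \<Sum>i\<in>UNIV. (x i)\<^sup>2) \<in> Lb (UNIV :: 'n set) \<rightarrow>\<^sub>M lborel"
      by simp
  qed auto
  then have "(\<lambda>x. \<Psi> R (x(a := (\<Sum>i\<in>UNIV. (x i)\<^sup>2)))) \<in> borel_measurable (Lb UNIV)"
    by (rule measurable_compose[OF _ measurable_\<Psi>])
  moreover have "(\<lambda>x. indicator {0..} (e * x a) :: ennreal) \<in> borel_measurable (Lb (UNIV :: 'n set))"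
    by measurable
  ultimately show ?thesis
    unfolding G_def[abs_def] by (rule borel_measurable_times_ennreal)
qed

lemma G_dominates:
  assumes x: "\<And>i. \<bar>x i\<bar> \<le> e * x a" and \<sigma>: "0 < (\<Sum>i\<in>UNIV. (x i)\<^sup>2)" "(\<Sum>i\<in>UNIV. (x i)\<^sup>2) < R\<^sup>2"
  shows "(\<Prod>j\<in>S. epowr (q j) (ennreal (\<bar>f j (restrict x (- V j))\<bar> powr p j))) \<le> G R x"
proof -
  define \<sigma> where "\<sigma> = (\<Sum>i\<in>UNIV. (x i)\<^sup>2)"
  have x2: "(x i)\<^sup>2 \<le> (x a)\<^sup>2" for i
    using x[of i] e by (metis abs_le_square_iff abs_mult abs_of_nonneg abs_ge_zero mult_1 order_trans abs_ge_self)
  have "\<sigma> \<le> real CARD('n) * (x a)\<^sup>2"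
    unfolding \<sigma>_def using sum_bounded_above[of UNIV "\<lambda>i. (x i)\<^sup>2", OF x2] by simp
  moreover have "\<sigma> = (x a)\<^sup>2 + (\<Sum>i\<in>-{a}. (x i)\<^sup>2)"
    unfolding \<sigma>_def using sum.remove[of UNIV a "\<lambda>i. (x i)\<^sup>2"] by (simp add: Compl_eq_Diff_UNIV)
  moreover have "(\<Sum>i\<in>-{a}. ((x(a := \<sigma>)) i)\<^sup>2) = (\<Sum>i\<in>-{a}. (x i)\<^sup>2)"
    by (intro sum.cong) auto
  moreover have "0 \<le> e * x a"
    using x[of a] by simp
  ultimately have "G R x = (\<Prod>j\<in>S. epowr (q j) (hh j (x(a := \<sigma>))))"
    using \<sigma> unfolding G_def \<Psi>_def \<sigma>_def[symmetric] by (simp del: fun_upd_apply add: fun_upd_same)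
  moreover have "(\<Prod>j\<in>S. epowr (q j) (ennreal (\<bar>f j (restrict x (- V j))\<bar> powr p j)))
      \<le> (\<Prod>j\<in>S. epowr (q j) (hh j (x(a := \<sigma>))))"
    by (intro prod_mono_ennreal epowr_mono region_function.h_dominates[OF region])
      (use x \<sigma> p \<sigma>_def in \<open>auto simp: less_imp_le\<close>)
  ultimately show ?thesis
    by simp
qed

text \<open>With the other coordinates fixed, x_a is exchanged for \<sigma>. The order of
  integration is then reversed, so that \<open>nn_integral_slice\<close> handles each sphere
  \<sigma> = r^2 and \<sigma> is integrated last.\<close>

lemma nn_integral_G:
  assumes R: "0 < R"
  shows "(\<integral>\<^sup>+x. G R x \<partial>Lb UNIV)
    \<le> ennreal (C0 * (2 / \<delta>) * R powr \<delta>) * (\<Prod>j\<in>S. epowr (q j) (\<integral>\<^sup>+x. g j x \<partial>Lb (- V j)))" (is "_ \<le> _ * ?G")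
proof -
  define n where "n = CARD('n)"
  have n: "0 < n"
    by (simp add: n_def)
  have UNIV: "UNIV = insert a (- {a})"
    by auto
  have upd: "(\<lambda>t. x(a := t)) \<in> borel \<rightarrow>\<^sub>M Lb UNIV" if "x \<in> space (Lb (-{a}))" for x :: "'n \<Rightarrow> real"
    using that by (intro measurable_fun_upd[where J="-{a}"]) auto
  define H where "H y = ennreal (sqrt (real n) / (2 * sqrt (y a))) * \<Psi> R y" for y
  have H: "H \<in> borel_measurable (Lb UNIV)"
  proof -
    have [measurable]: "(\<lambda>y. y a) \<in> borel_measurable (Lb UNIV)"
      by (rule measurable_component_Lb) simp
    show ?thesis
      unfolding H_def[abs_def] by measurable
  qed
  have "(\<integral>\<^sup>+x. G R x \<partial>Lb UNIV) = (\<integral>\<^sup>+x. (\<integral>\<^sup>+t. G R (x(a := t)) \<partial>lborel) \<partial>Lb (-{a}))"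
    using measurable_G unfolding UNIV by (intro lborel_prod.product_nn_integral_insert) auto
  also have "\<dots> \<le> (\<integral>\<^sup>+x. (\<integral>\<^sup>+s. H (x(a := s)) \<partial>lborel) \<partial>Lb (-{a}))"
  proof (rule nn_integral_mono)
    fix x :: "'n \<Rightarrow> real" assume x: "x \<in> space (Lb (-{a}))"
    define c where "c = (\<Sum>i\<in>-{a}. (x i)\<^sup>2)"
    have sum_upd: "(\<Sum>i\<in>-{a}. ((x(a := t)) i)\<^sup>2) = c" for t
      unfolding c_def by (intro sum.cong) auto
    have "(\<Sum>i\<in>UNIV. ((x(a := t)) i)\<^sup>2) = c + t\<^sup>2" for t
      using sum.remove[of UNIV a "\<lambda>i. ((x(a := t)) i)\<^sup>2"] sum_upd[of t] by (simp add: Compl_eq_Diff_UNIV)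
    then have G_eq: "G R (x(a := t)) = \<Psi> R (x(a := c + t\<^sup>2)) * indicator {0..} (e * t)" for t
      by (simp add: G_def)
    have "(\<integral>\<^sup>+t. \<Psi> R (x(a := c + t\<^sup>2)) * indicator {0..} (e * t) \<partial>lborel)
      \<le> (\<integral>\<^sup>+s. ennreal (sqrt (real n) / (2 * sqrt s)) * \<Psi> R (x(a := s)) \<partial>lborel)"
    proof (rule nn_integral_half_line_square[where \<Psi> = "\<lambda>s. \<Psi> R (x(a := s))"])
      show "(\<lambda>s. \<Psi> R (x(a := s))) \<in> borel_measurable borel"
        by (rule measurable_compose[OF upd[OF x] measurable_\<Psi>])
      show "\<Psi> R (x(a := s)) = 0" if "s \<le> 0" for s
        using that by (simp add: \<Psi>_def)
      show "s \<le> (sqrt (real n))\<^sup>2 * (s - c)" if "\<Psi> R (x(a := s)) \<noteq> 0" for s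
        using that unfolding \<Psi>_def by (simp add: n_def c_def indicator_def split: if_splits)
    qed (use n e in auto)
    then show "(\<integral>\<^sup>+t. G R (x(a := t)) \<partial>lborel) \<le> (\<integral>\<^sup>+s. H (x(a := s)) \<partial>lborel)"
      by (simp add: G_eq H_def)
  qed
  also have "\<dots> = (\<integral>\<^sup>+y. H y \<partial>Lb UNIV)"
    using H unfolding UNIV by (intro lborel_prod.product_nn_integral_insert[symmetric]) auto
  also have "\<dots> = (\<integral>\<^sup>+s. (\<integral>\<^sup>+x. H (x(a := s)) \<partial>Lb (-{a})) \<partial>lborel)"
    using H unfolding UNIV by (intro lborel_prod.product_nn_integral_insert_rev) auto
  also have "\<dots> \<le> (\<integral>\<^sup>+s. ennreal C0 * ?G * (ennreal (s powr (\<delta> / 2 - 1)) * indicator {0..R\<^sup>2} s) \<partial>lborel)"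
  proof (rule nn_integral_mono)
    fix s :: real
    show "(\<integral>\<^sup>+x. H (x(a := s)) \<partial>Lb (-{a})) \<le> ennreal C0 * ?G * (ennreal (s powr (\<delta> / 2 - 1)) * indicator {0..R\<^sup>2} s)"
    proof (cases "0 < s \<and> s < R\<^sup>2")
      case False
      then have "H (x(a := s)) = 0" for x
        by (auto simp: H_def \<Psi>_def)
      then show ?thesis
        by simp
    next
      case True
      define r where "r = sqrt s"
      have r: "0 < r" "r\<^sup>2 = s"
        using True by (auto simp: r_def)
      define P where "P x = (\<Prod>j\<in>S. epowr (q j) (hh j (x(a := r\<^sup>2)))) * indicator {x. \<forall>i\<in>-{a}. \<bar>x i\<bar> \<le> r} x" for x
      \<comment> \<open>The last condition in \<open>\<Psi>\<close> and s > 0 force the sum of the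
        other squares below s = r^2, which puts each of these coordinates into [-r, r].\<close>
      have "\<Psi> R (x(a := s)) \<le> P x" for x
      proof (cases "s \<le> real n * (s - (\<Sum>i\<in>-{a}. (x i)\<^sup>2))")
        case True
        then have "0 < real n * (s - (\<Sum>i\<in>-{a}. (x i)\<^sup>2))"
          using \<open>0 < s \<and> s < R\<^sup>2\<close> by linarith
        then have "(\<Sum>i\<in>-{a}. (x i)\<^sup>2) < s"
          using n by (simp add: zero_less_mult_iff)
        then have "\<bar>x i\<bar> \<le> r" if "i \<in> - {a}" for i
          using member_le_sum[of i "-{a}" "\<lambda>i. (x i)\<^sup>2"] that r
          by (intro power2_le_imp_le[of "\<bar>x i\<bar>" r]) auto
        then show ?thesis
          by (simp add: \<Psi>_def P_def r indicator_def)
      next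
        case False
        moreover have "(\<Sum>i\<in>-{a}. ((x(a := s)) i)\<^sup>2) = (\<Sum>i\<in>-{a}. (x i)\<^sup>2)"
          by (intro sum.cong) auto
        ultimately have "\<Psi> R (x(a := s)) = 0"
          unfolding \<Psi>_def by (simp add: n_def)
        then show ?thesis
          by simp
      qed
      then have "(\<integral>\<^sup>+x. H (x(a := s)) \<partial>Lb (-{a})) \<le> (\<integral>\<^sup>+x. ennreal (sqrt (real n) / (2 * r)) * P x \<partial>Lb (-{a}))"
        by (intro nn_integral_mono) (simp add: H_def r_def mult_left_mono)
      also have "\<dots> = ennreal (sqrt (real n) / (2 * r)) * (\<integral>\<^sup>+x. P x \<partial>Lb (-{a}))"
      proof (rule nn_integral_cmult)
        show "P \<in> borel_measurable (Lb (-{a}))"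
          unfolding P_def[abs_def]
          by (intro borel_measurable_times_ennreal borel_measurable_prod_ennreal measurable_epowr
            measurable_hh_upd measurable_cube_indicator) auto
      qed
      also have "\<dots> \<le> ennreal (sqrt (real n) / (2 * r)) *
        (ennreal (2 ^ (n - 1) * (pi * real n ^ n) powr (\<Sum>j\<in>S. q j) * r powr (\<delta> - 1)) * ?G)"
        unfolding P_def n_def using nn_integral_slice[OF r(1)] by (rule mult_left_mono) simp
      also have "\<dots> = ennreal (sqrt (real n) / (2 * r) *
          (2 ^ (n - 1) * (pi * real n ^ n) powr (\<Sum>j\<in>S. q j) * r powr (\<delta> - 1))) * ?G"
        using r by (subst ennreal_mult[of "sqrt (real n) / (2 * r)"]) (auto simp: mult.assoc)
      also have "sqrt (real n) / (2 * r) * (2 ^ (n - 1) * (pi * real n ^ n) powr (\<Sum>j\<in>S. q j) * r powr (\<delta> - 1))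
          = C0 * s powr (\<delta> / 2 - 1)"
      proof -
        \<comment> \<open>The Jacobian gives r^-1 and the slice r^(\<delta> - 1); with s = r^2 the
          product is s^((\<delta> - 2) / 2).\<close>
        have "s powr (\<delta> / 2 - 1) = (r powr 2) powr (\<delta> / 2 - 1)"
          using r by simp
        also have "\<dots> = r powr ((\<delta> - 1) - 1)"
          by (simp add: powr_powr algebra_simps)
        also have "\<dots> = r powr (\<delta> - 1) / r"
          using r by (simp only: powr_diff) simp
        finally show ?thesis
          by (simp add: C0_def n_def)
      qed
      also have "ennreal (C0 * s powr (\<delta> / 2 - 1)) = ennreal C0 * ennreal (s powr (\<delta> / 2 - 1))"
        using C0_pos by (intro ennreal_mult) auto
      finally show ?thesis
        using True by (simp add: mult_ac del: fun_upd_apply)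
    qed
  qed
  also have "\<dots> = ennreal C0 * ?G * (\<integral>\<^sup>+s. ennreal (s powr (\<delta> / 2 - 1)) * indicator {0..R\<^sup>2} s \<partial>lborel)"
    by (rule nn_integral_cmult) measurable
  \<comment> \<open>The singularity at 0 is integrable since \<delta> > 0; the value is
    (R^2)^(\<delta> / 2) divided by \<delta> / 2.\<close>
  also have "(\<integral>\<^sup>+s. ennreal (s powr (\<delta> / 2 - 1)) * indicator {0..R\<^sup>2} s \<partial>lborel) = ennreal (2 / \<delta> * R powr \<delta>)"
  proof -
    have "R\<^sup>2 powr (\<delta> / 2) = (R powr 2) powr (\<delta> / 2)"
      using R by simp
    also have "\<dots> = R powr \<delta>"
      by (simp add: powr_powr)
    finally show ?thesis
      using \<delta>(2) by (subst nn_integral_powr_from_0) auto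
  qed
  also have "ennreal C0 * ?G * ennreal (2 / \<delta> * R powr \<delta>) = ennreal C0 * ennreal (2 / \<delta> * R powr \<delta>) * ?G"
    by (simp only: mult_ac)
  also have "ennreal C0 * ennreal (2 / \<delta> * R powr \<delta>) = ennreal (C0 * (2 / \<delta>) * R powr \<delta>)"
    using C0_pos \<delta>(2) by (subst ennreal_mult[symmetric]) (auto simp: mult.assoc)
  finally show ?thesis .
qed

end

section \<open>Assembling the regions\<close>

lemma lebesgue_index_majorant:
  fixes f :: "('n::finite \<Rightarrow> real) \<Rightarrow> real"
  assumes "f \<in> borel_measurable (lebesgue_index W)"
  obtains g where "g \<in> borel_measurable (Lb W)"
    "\<And>x. x \<in> space (Lb W) \<Longrightarrow> ennreal (\<bar>f x\<bar> powr p) \<le> g x"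
    "epowr (1 / p) (\<integral>\<^sup>+x. g x \<partial>Lb W) = Lp_norm p (lebesgue_index W) f"
proof -
  have "(\<lambda>x. ennreal (\<bar>f x\<bar> powr p)) \<in> borel_measurable (completion (Lb W))"
    using assms unfolding lebesgue_index_def by measurable
  then obtain g where "g \<in> borel_measurable (Lb W)" "\<And>x. x \<in> space (Lb W) \<Longrightarrow> ennreal (\<bar>f x\<bar> powr p) \<le> g x"
    "(\<integral>\<^sup>+x. g x \<partial>Lb W) = (\<integral>\<^sup>+x. ennreal (\<bar>f x\<bar> powr p) \<partial>completion (Lb W))"
    by (rule completion_borel_majorant) blast
  then show ?thesis
    by (intro that[of g]) (auto simp: Lp_norm_def epowr_def lebesgue_index_def Let_def)
qed

lemma region_function_symmetric:
  fixes f :: "('n::{finite,linorder} \<Rightarrow> real) \<Rightarrow> real"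
  assumes lab: "labeling A N \<alpha>" and sym: "symmetric_fun N \<alpha> (\<lambda>x. f (coords (- \<alpha> 1) x))" and e: "\<bar>e\<bar> = 1"
    and g: "g \<in> borel_measurable (Lb (- \<alpha> 1))" "\<And>x. x \<in> space (Lb (- \<alpha> 1)) \<Longrightarrow> ennreal (\<bar>f x\<bar> powr p) \<le> g x"
  shows "region_function f (\<alpha> 1) (block N \<alpha> a) a e p g"
proof
  have N: "1 \<in> {1..N}"
    using lab by (simp add: labeling_def)
  then show "2 \<le> card (\<alpha> 1)"
    using lab unfolding labeling_def by blast
  show "block N \<alpha> a = \<alpha> 1 \<or> block N \<alpha> a \<inter> \<alpha> 1 = {}"
  proof (cases "\<exists>i\<in>{1..N}. a \<in> \<alpha> i")
    case True
    then obtain i where i: "i \<in> {1..N}" "a \<in> \<alpha> i"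
      by blast
    then have "i = 1 \<or> disjnt (\<alpha> i) (\<alpha> 1)"
      using lab N unfolding labeling_def by blast
    then show ?thesis
      using block_eq[OF lab i] by (auto simp: disjnt_def)
  next
    case False
    then have "block N \<alpha> a = {a}" "a \<notin> \<alpha> 1"
      using N by (auto intro!: block_singleton)
    then show ?thesis
      by simp
  qed
  show "f (restrict x (- \<alpha> 1)) = f (restrict y (- \<alpha> 1))"
    if "\<And>i. i \<notin> block N \<alpha> a \<Longrightarrow> x i = y i" "(\<Sum>i\<in>block N \<alpha> a. (x i)\<^sup>2) = (\<Sum>i\<in>block N \<alpha> a. (y i)\<^sup>2)"
      "0 \<le> e * x a" "0 \<le> e * y a" for x y
    using symmetric_fun_invariant[OF lab sym e that] .
qed (use e g in \<open>auto simp: block_def\<close>)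

theorem theorem5p1:
  fixes m :: nat
    and A :: "nat \<Rightarrow> (real ^ 'n::{finite,linorder} ^ 'n::{finite,linorder}) set"
    and N :: "nat \<Rightarrow> nat"
    and \<alpha> :: "nat \<Rightarrow> nat \<Rightarrow> 'n::{finite,linorder} set"
  assumes "CARD('n) \<ge> 3"
    and "m \<ge> 1"
    and "\<And>J. J \<in> {1..m} \<Longrightarrow> maximal (A J) \<and> A J \<noteq> {} \<and> A J \<noteq> Ls"
    and "\<And>J. J \<in> {1..m} \<Longrightarrow> labeling (A J) (N J) (\<alpha> J)"
  shows "delta_tilde m A \<alpha> > 0 \<and>
    (\<exists>C>0. \<forall>R>0. \<forall>f :: nat \<Rightarrow> ('n \<Rightarrow> real) \<Rightarrow> real.
      (\<forall>J\<in>{1..m}.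
         f J \<in> borel_measurable (lebesgue_index (- \<alpha> J 1)) \<and>
         (\<forall>y\<in>space (lebesgue_index (- \<alpha> J 1)). f J y \<ge> 0) \<and>
         symmetric_fun (N J) (\<alpha> J) (\<lambda>x. f J (coords (- \<alpha> J 1) x))) \<longrightarrow>
      (\<integral>\<^sup>+ x \<in> ball (0 :: real ^ 'n::{finite,linorder}) R.
          ennreal (\<Prod>J=1..m. f J (coords (- \<alpha> J 1) x)) \<partial>lebesgue)
        \<le> ennreal (C * R powr delta_tilde m A \<alpha>) *
          (\<Prod>J=1..m. Lp_norm (real (p_tilde m A J)) (lebesgue_index (- \<alpha> J 1)) (f J)))"
proof -
  define n where "n = CARD('n)"
  define S where "S = {1..m}"
  define p where "p J = real (p_tilde m A J)" for J
  define \<delta> where "\<delta> = delta_tilde m A \<alpha>"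
  note lab = assms(4)
  have \<delta>_pos: "0 < \<delta>"
    using delta_tilde_ge_1[of m A N \<alpha>] lab by (simp add: \<delta>_def)
  have p_pos: "0 < p J" if "J \<in> S" for J
  proof -
    have "A J \<subseteq> Ls" "A J \<noteq> Ls"
      using assms(3) that unfolding S_def maximal_def by blast+
    then obtain X where "X \<in> Ls - A J"
      by blast
    then show ?thesis
      using p_tilde_pos that by (simp add: p_def S_def)
  qed
  \<comment> \<open>This is \<open>C0\<close> times the factor 2 / \<delta> from the integral over
    \<sigma>; \<open>C\<close> multiplies it by the number 2 n of regions. Both are fixed before R
    and f.\<close>
  define c where "c = sqrt (real n) / 2 * 2 ^ (n - 1) * (pi * real n ^ n) powr (\<Sum>J\<in>S. inverse (p J)) * (2 / \<delta>)"
  have c: "0 < c"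
    using \<delta>_pos by (simp add: c_def n_def)
  define C where "C = 2 * real n * c"
  have C: "0 < C"
    using c by (simp add: C_def n_def)
  have main: "(\<integral>\<^sup>+ x \<in> ball (0 :: real ^ 'n::{finite,linorder}) R.
          ennreal (\<Prod>J=1..m. f J (coords (- \<alpha> J 1) x)) \<partial>lebesgue)
        \<le> ennreal (C * R powr \<delta>) * (\<Prod>J\<in>S. Lp_norm (p J) (lebesgue_index (- \<alpha> J 1)) (f J))"
    if R: "0 < R" and f: "\<And>J. J \<in> S \<Longrightarrow> f J \<in> borel_measurable (lebesgue_index (- \<alpha> J 1))"
      "\<And>J y. J \<in> S \<Longrightarrow> y \<in> space (lebesgue_index (- \<alpha> J 1)) \<Longrightarrow> 0 \<le> f J y"
      "\<And>J. J \<in> S \<Longrightarrow> symmetric_fun (N J) (\<alpha> J) (\<lambda>x. f J (coords (- \<alpha> J 1) x))"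
    for R and f :: "nat \<Rightarrow> ('n \<Rightarrow> real) \<Rightarrow> real"
  proof -
    have "\<exists>g. g \<in> borel_measurable (Lb (- \<alpha> J 1)) \<and>
        (\<forall>x\<in>space (Lb (- \<alpha> J 1)). ennreal (\<bar>f J x\<bar> powr p J) \<le> g x) \<and>
        epowr (1 / p J) (\<integral>\<^sup>+x. g x \<partial>Lb (- \<alpha> J 1)) = Lp_norm (p J) (lebesgue_index (- \<alpha> J 1)) (f J)" if "J \<in> S" for J
      using lebesgue_index_majorant[OF f(1)[OF that], of "p J"] by metis
    then obtain g where g: "\<And>J. J \<in> S \<Longrightarrow> g J \<in> borel_measurable (Lb (- \<alpha> J 1))"
      "\<And>J x. J \<in> S \<Longrightarrow> x \<in> space (Lb (- \<alpha> J 1)) \<Longrightarrow> ennreal (\<bar>f J x\<bar> powr p J) \<le> g J x"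
      "\<And>J. J \<in> S \<Longrightarrow> epowr (1 / p J) (\<integral>\<^sup>+x. g J x \<partial>Lb (- \<alpha> J 1)) = Lp_norm (p J) (lebesgue_index (- \<alpha> J 1)) (f J)"
      by metis
    define B where "B a J = block (N J) (\<alpha> J) a" for a J
    have family: "region_family S f (\<lambda>J. \<alpha> J 1) (B a) a e p g \<delta>" if e: "\<bar>e\<bar> = 1" for a e
    proof (rule region_family.intro)
      show "finite S"
        by (simp add: S_def)
      show "region_function (f J) (\<alpha> J 1) (B a J) a e (p J) (g J)" if "J \<in> S" for J
        unfolding B_def using that f(3) g(1,2) e lab[of J]
        by (intro region_function_symmetric[where A = "A J"]) (simp_all add: S_def)
      show "(\<Sum>J | J \<in> S \<and> i \<notin> B a J. inverse (p J)) \<le> 1" if "i \<noteq> a" for i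
        unfolding B_def p_def S_def using lab that by (rule sum_inverse_p_tilde_le)
      show "\<delta> = real CARD('n) - (\<Sum>J\<in>S. inverse (p J) * (real CARD('n) - real (card (\<alpha> J 1))))"
        by (simp add: \<delta>_def delta_tilde_def S_def p_def)
    qed (use e p_pos \<delta>_pos in auto)
    define \<G> where "\<G> z = region_family.G S (\<lambda>J. \<alpha> J 1) (B (fst z)) (fst z) (snd z) p g R" for z
    define Z where "Z = (UNIV :: 'n set) \<times> {1, -1 :: real}"
    define P where "P = (\<Prod>J\<in>S. Lp_norm (p J) (lebesgue_index (- \<alpha> J 1)) (f J))"
    have Z: "finite Z" "card Z = 2 * n" "\<And>z. z \<in> Z \<Longrightarrow> \<bar>snd z\<bar> = 1"
      by (auto simp: Z_def n_def card_cartesian_product)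
    have \<G>_measurable: "\<G> z \<in> borel_measurable (Lb UNIV)" if "z \<in> Z" for z
      unfolding \<G>_def using family[OF Z(3)[OF that]] by (rule region_family.measurable_G)
    have \<G>_integral: "(\<integral>\<^sup>+y. \<G> z y \<partial>Lb UNIV) \<le> ennreal (c * R powr \<delta>) * P" if "z \<in> Z" for z
    proof -
      have "P = (\<Prod>J\<in>S. epowr (inverse (p J)) (\<integral>\<^sup>+x. g J x \<partial>Lb (- \<alpha> J 1)))"
        unfolding P_def by (intro prod.cong refl) (use g(3) in \<open>simp add: inverse_eq_divide\<close>)
      moreover have "c = region_family.C0 TYPE('n) S p * (2 / \<delta>)"
        using region_family.C0_def[OF family[OF Z(3)[OF that]]] by (simp add: c_def n_def)
      ultimately show ?thesis
        using region_family.nn_integral_G[OF family[OF Z(3)[OF that], of "fst z"] R] by (simp add: \<G>_def)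
    qed
    \<comment> \<open>The origin, a null set, is excluded because \<open>G_dominates\<close> asks
      for \<sigma> > 0. Regions overlap where coordinates tie in absolute value; a sum over all
      regions still dominates.\<close>
    have dominate: "ennreal (\<Prod>J=1..m. f J (coords (- \<alpha> J 1) x)) * indicator (ball 0 R) x
        \<le> (\<Sum>z\<in>Z. \<G> z (\<lambda>i. x $ i))" if "x \<noteq> 0" for x :: "real ^ 'n::{finite,linorder}"
    proof (cases "x \<in> ball 0 R")
      case True
      have norm: "(norm x)\<^sup>2 = (\<Sum>i\<in>UNIV. (x $ i)\<^sup>2)"
        by (simp add: norm_vec_def L2_set_def sum_nonneg)
      have "0 < (norm x)\<^sup>2" "(norm x)\<^sup>2 < R\<^sup>2"
        using that True R by (auto intro!: power_strict_mono)
      have "Max (range (\<lambda>i. \<bar>x $ i\<bar>)) \<in> range (\<lambda>i. \<bar>x $ i\<bar>)"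
        by (intro Max_in) auto
      then obtain a where "\<bar>x $ a\<bar> = Max (range (\<lambda>i. \<bar>x $ i\<bar>))"
        by force
      then have a: "\<bar>x $ i\<bar> \<le> \<bar>x $ a\<bar>" for i
        by simp
      define e :: real where "e = (if 0 \<le> x $ a then 1 else - 1)"
      have z: "(a, e) \<in> Z"
        by (simp add: Z_def e_def)
      have "ennreal (\<Prod>J=1..m. f J (coords (- \<alpha> J 1) x)) = (\<Prod>J\<in>S. ennreal (f J (coords (- \<alpha> J 1) x)))"
        unfolding S_def[symmetric] using f(2)
        by (intro prod_ennreal[symmetric]) (auto simp: coords_def lebesgue_index_def space_PiM)
      \<comment> \<open>Since q_J p_J = 1, each nonnegative factor is the q_J-th power of its own
        p_J-th power, the form in which the majorants enter.\<close>
      also have "\<dots> = (\<Prod>J\<in>S. epowr (inverse (p J)) (ennreal (\<bar>f J (restrict (\<lambda>i. x $ i) (- \<alpha> J 1))\<bar> powr p J)))"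
      proof (intro prod.cong refl)
        fix J assume J: "J \<in> S"
        have "0 \<le> f J (coords (- \<alpha> J 1) x)"
          using f(2)[OF J] by (auto simp: coords_def lebesgue_index_def space_PiM)
        then show "ennreal (f J (coords (- \<alpha> J 1) x))
          = epowr (inverse (p J)) (ennreal (\<bar>f J (restrict (\<lambda>i. x $ i) (- \<alpha> J 1))\<bar> powr p J))"
          using p_pos[OF J] by (simp add: epowr_ennreal powr_powr coords_def)
      qed
      also have "\<dots> \<le> \<G> (a, e) (\<lambda>i. x $ i)"
        unfolding \<G>_def fst_conv snd_conv
      proof (rule region_family.G_dominates[OF family])
        show "\<bar>x $ i\<bar> \<le> e * x $ a" for i
          using a[of i] by (cases "0 \<le> x $ a") (simp_all add: e_def)
      qed (use \<open>0 < (norm x)\<^sup>2\<close> \<open>(norm x)\<^sup>2 < R\<^sup>2\<close> in \<open>auto simp: norm e_def\<close>)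
      also have "\<dots> \<le> (\<Sum>z\<in>Z. \<G> z (\<lambda>i. x $ i))"
        using Z(1) z by (intro member_le_sum) auto
      finally show ?thesis
        using True by simp
    qed simp
    \<comment> \<open>Nonnegative integrals over the completed measure and over
      \<open>lborel\<close> agree, so domination by the Borel functions \<open>\<G> z\<close>
      outside the origin suffices.\<close>
    have "(\<integral>\<^sup>+ x \<in> ball (0 :: real ^ 'n::{finite,linorder}) R.
          ennreal (\<Prod>J=1..m. f J (coords (- \<alpha> J 1) x)) \<partial>lebesgue)
        \<le> (\<integral>\<^sup>+x. (\<Sum>z\<in>Z. \<G> z (\<lambda>i. x $ i)) \<partial>(lborel :: (real ^ 'n::{finite,linorder}) measure))"
      unfolding nn_integral_completion
      by (rule nn_integral_mono_AE, rule eventually_mono[OF AE_lborel_singleton[of 0]]) (rule dominate)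
    also have "\<dots> = (\<Sum>z\<in>Z. \<integral>\<^sup>+x. \<G> z (\<lambda>i. x $ i) \<partial>(lborel :: (real ^ 'n::{finite,linorder}) measure))"
      using measurable_compose[OF measurable_vec_nth_Lb \<G>_measurable] by (intro nn_integral_sum) simp
    also have "\<dots> = (\<Sum>z\<in>Z. \<integral>\<^sup>+y. \<G> z y \<partial>Lb UNIV)"
      by (intro sum.cong refl nn_integral_lborel_vec \<G>_measurable)
    also have "\<dots> \<le> (\<Sum>z\<in>Z. ennreal (c * R powr \<delta>) * P)"
      by (intro sum_mono \<G>_integral)
    also have "\<dots> = ennreal (C * R powr \<delta>) * P"
    proof -
      have "C * R powr \<delta> = real (card Z) * (c * R powr \<delta>)"
        by (simp add: C_def Z(2))
      also have "ennreal \<dots> = of_nat (card Z) * ennreal (c * R powr \<delta>)"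
        using c by (simp add: ennreal_mult ennreal_of_nat_eq_real_of_nat)
      finally show ?thesis
        by (simp add: mult.assoc)
    qed
    finally show ?thesis
      by (simp add: P_def)
  qed
  show ?thesis
    using \<delta>_pos C main unfolding \<delta>_def[symmetric] p_def[symmetric] S_def[symmetric]
    by (intro conjI exI[of _ C] allI impI) auto
qed

end
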